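(* Let $V\in\Gamma_{sc}^2(\mathbb{R}^m)$ and let $(\overline{x},\overline{\sigma})\in X_0\times S^-$ be a critical point of $\Xi$ such that $\det\nabla^2f(\overline{x})\neq0$. Let $E$ be a real $n\times n$ matrix with $E^*E=-A(\overline{\sigma})$ and $F$ a real $m\times m$ matrix with $F^*F=\nabla^2V(q(\overline{x}))$ (both are then non-singular), let $d_i:=(E^{-1})^*(A_i\overline{x}-b_i)\in\mathbb{R}^n$ for $i\in\{1,\dots,m\}$, let $J:\mathbb{R}^m\to\mathbb{R}^n$, $Jv:=\sum_{i=1}^mv_id_i$, and let $H:=J\circ F^*:\mathbb{R}^m\to\mathbb{R}^n$. Let $S_m$ denote the Euclidean unit sphere of $\mathbb{R}^m$. Then: (a) $\overline{x}$ is a local maximizer of $f$ if and only if $\|Hv\|<1$ for all $v\in S_m$, if and only if $\overline{\sigma}$ is a local maximizer of $D$. (b) Assume that $m=n$. Then $\overline{x}$ is a local minimizer of $f$ if and only if $\|Hv\|>1$ for all $v\in S_m$, if and only if $\overline{\sigma}$ is a local minimizer of $D$.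
   Context: $\Gamma(\mathbb{R}^m)$ is the class of proper convex lower semicontinuous functions $g:\mathbb{R}^m\to\overline{\mathbb{R}}=\mathbb{R}\cup\{-\infty,+\infty\}$; $\operatorname{dom}g=\{y: g(y)<\infty\}$; $g^*(\sigma)=\sup_{y}\{\langle y,\sigma\rangle-g(y)\}$ is the Fenchel conjugate. $\Gamma_{sc}(\mathbb{R}^m)$ is the class of $g\in\Gamma(\mathbb{R}^m)$ of Legendre type, i.e. essentially smooth ($\operatorname{int}(\operatorname{dom}g)\ne\emptyset$, $g$ differentiable there, and $\|\nabla g(y_k)\|\to\infty$ whenever $(y_k)\subset\operatorname{int}(\operatorname{dom}g)$ converges to a boundary point of $\operatorname{int}(\operatorname{dom}g)$) and essentially strictly convex (strictly convex on every convex subset of $\{y:\partial g(y)\neq\emptyset\}$). $\Gamma_{sc}^2(\mathbb{R}^m)$ is the class of $g\in\Gamma_{sc}(\mathbb{R}^m)$ that are twice differentiable on $\operatorname{int}(\operatorname{dom}g)$ with $\nabla^2g(y)\succ0$ for all $y\in\operatorname{int}(\operatorname{dom}g)$; then $g^*\in\Gamma_{sc}^2(\mathbb{R}^m)$. For $i\in\{0,\dots,m\}$ let $q_i(x)=\tfrac12\langle x,A_ix\rangle-\langle b_i,x\rangle+c_i$ on $\mathbb{R}^n$, with $A_i$ a real symmetric $n\times n$ matrix, $b_i\in\mathbb{R}^n$, $c_i\in\mathbb{R}$, and $q(x)=(q_1(x),\dots,q_m(x))^T$. Let $f:=q_0+V\circ q$ and $X_0:=\{x\in\mathbb{R}^n: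 q(x)\in\operatorname{int}(\operatorname{dom}V)\}$. For $\sigma\in\mathbb{R}^m$ put, with $\sigma_0:=1$, $A(\sigma)=\sum_{k=0}^m\sigma_kA_k$, $b(\sigma)=\sum_{k=0}^m\sigma_kb_k$, $c(\sigma)=\sum_{k=0}^m\sigma_kc_k$, and let $$\Xi(x,\sigma)=q_0(x)+\langle q(x),\sigma\rangle-V^*(\sigma)=\tfrac12\langle x,A(\sigma)x\rangle-\langle b(\sigma),x\rangle+c(\sigma)-V^*(\sigma).$$ Sets: $S_{\mathrm{col}}=\{\sigma\in\operatorname{dom}V^*: b(\sigma)\in\operatorname{Im}A(\sigma)\}$; $S^-=\{\sigma\in\operatorname{dom}V^*:A(\sigma)\prec0\}$. The dual function is $D:S_{\mathrm{col}}\to\mathbb{R}$, $D(\sigma):=\Xi(x,\sigma)$ for any $x$ with $A(\sigma)x=b(\sigma)$ (the value does not depend on the choice of such $x$). "$(\overline{x},\overline{\sigma})$ is a critical point of $\Xi$" means $\overline{\sigma}\in\operatorname{int}(\operatorname{dom}V^* )$ and $\nabla\Xi(\overline{x},\overline{\sigma})=0$ (equivalently $\overline{\sigma}=\nabla V(q(\overline{x}))$ and $A(\overline{\sigma})\overline{x}=b(\overline{\sigma})$). A star on a matrix or linear operator denotes transpose/adjoint. *)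

theory Defs
  imports "HOL-Analysis.Analysis"
begin

section \<open>Differential calculus\<close>

definition gradient :: "('a::real_inner \<Rightarrow> real) \<Rightarrow> 'a \<Rightarrow> 'a" where
  "gradient f x = (THE D. GDERIV f x :> D)"

definition hessian :: "(real^'n \<Rightarrow> real) \<Rightarrow> real^'n \<Rightarrow> real^'n^'n" where
  "hessian f x = jacobian (gradient f) (at x)"

lemma gradient_eqI:
  assumes "GDERIV f x :> D"
  shows "gradient f x = D"
  unfolding gradient_def
proof (rule the_equality)
  fix D' assume "GDERIV f x :> D'"
  then have "(\<lambda>h. h \<bullet> D') = (\<lambda>h. h \<bullet> D)"
    using assms unfolding gderiv_def by (rule has_derivative_unique)
  then show "D' = D"
    by (metis inner_commute vector_eq_rdot)
qed (rule assms)

lemma GDERIV_gradient: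
  fixes f :: "'a::euclidean_space \<Rightarrow> real"
  assumes "f differentiable (at x)"
  shows "GDERIV f x :> gradient f x"
proof -
  obtain f' where f': "(f has_derivative f') (at x)"
    using assms by (auto simp: differentiable_def)
  then interpret bounded_linear f'
    by (rule has_derivative_bounded_linear)
  have "f' = (\<lambda>h. h \<bullet> (\<Sum>b\<in>Basis. f' b *\<^sub>R b))"
  proof
    fix h
    have "f' h = f' (\<Sum>b\<in>Basis. (h \<bullet> b) *\<^sub>R b)"
      by (simp add: euclidean_representation)
    then show "f' h = h \<bullet> (\<Sum>b\<in>Basis. f' b *\<^sub>R b)"
      by (simp add: sum scaleR inner_sum_right mult.commute)
  qed
  then have "GDERIV f x :> (\<Sum>b\<in>Basis. f' b *\<^sub>R b)"
    unfolding gderiv_def by (rule subst) (rule f')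
  moreover from this have "gradient f x = (\<Sum>b\<in>Basis. f' b *\<^sub>R b)"
    by (rule gradient_eqI)
  ultimately show ?thesis
    by simp
qed

definition pos_definite :: "real^'n^'n \<Rightarrow> bool" where
  "pos_definite M \<longleftrightarrow> transpose M = M \<and> (\<forall>x. x \<noteq> 0 \<longrightarrow> x \<bullet> (M *v x) > 0)"

definition neg_definite :: "real^'n^'n \<Rightarrow> bool" where
  "neg_definite M \<longleftrightarrow> transpose M = M \<and> (\<forall>x. x \<noteq> 0 \<longrightarrow> x \<bullet> (M *v x) < 0)"

definition local_maximizer_on :: "'a::metric_space set \<Rightarrow> ('a \<Rightarrow> 'b::order) \<Rightarrow> 'a \<Rightarrow> bool" where
  "local_maximizer_on S f x \<longleftrightarrow> x \<in> S \<and> (\<exists>e>0. \<forall>y\<in>S \<inter> ball x e. f y \<le> f x)"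

definition local_minimizer_on :: "'a::metric_space set \<Rightarrow> ('a \<Rightarrow> 'b::order) \<Rightarrow> 'a \<Rightarrow> bool" where
  "local_minimizer_on S f x \<longleftrightarrow> x \<in> S \<and> (\<exists>e>0. \<forall>y\<in>S \<inter> ball x e. f x \<le> f y)"


section \<open>Extended-real-valued convex functions\<close>

definition edom :: "('a \<Rightarrow> ereal) \<Rightarrow> 'a set" where
  "edom g = {y. g y < \<infinity>}"

definition fenchel_conj :: "('a::real_inner \<Rightarrow> ereal) \<Rightarrow> 'a \<Rightarrow> ereal" where
  "fenchel_conj g \<sigma> = (SUP y. ereal (y \<bullet> \<sigma>) - g y)"

definition proper :: "('a \<Rightarrow> ereal) \<Rightarrow> bool" where
  "proper g \<longleftrightarrow> edom g \<noteq> {} \<and> (\<forall>y. g y > -\<infinity>)"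

definition lower_semicont :: "('a::topological_space \<Rightarrow> ereal) \<Rightarrow> bool" where
  "lower_semicont g \<longleftrightarrow> (\<forall>y. g y \<le> Liminf (at y) g)"

text \<open>Only used for proper \<open>g\<close>, so that the right-hand side is never \<open>\<infinity> - \<infinity>\<close>.\<close>

definition econvex :: "('a::real_vector \<Rightarrow> ereal) \<Rightarrow> bool" where
  "econvex g \<longleftrightarrow> (\<forall>y z. \<forall>u::real. 0 < u \<and> u < 1 \<longrightarrow>
      g ((1 - u) *\<^sub>R y + u *\<^sub>R z) \<le> ereal (1 - u) * g y + ereal u * g z)"

definition strictly_econvex_on :: "'a::real_vector set \<Rightarrow> ('a \<Rightarrow> ereal) \<Rightarrow> bool" where
  "strictly_econvex_on C g \<longleftrightarrow> (\<forall>y\<in>C. \<forall>z\<in>C. \<forall>u::real. y \<noteq> z \<and> 0 < u \<and> u < 1 \<longrightarrow>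
      g ((1 - u) *\<^sub>R y + u *\<^sub>R z) < ereal (1 - u) * g y + ereal u * g z)"

definition subdifferential :: "('a::real_inner \<Rightarrow> ereal) \<Rightarrow> 'a \<Rightarrow> 'a set" where
  "subdifferential g y =
     {s. \<bar>g y\<bar> \<noteq> \<infinity> \<and> (\<forall>z. g y + ereal ((z - y) \<bullet> s) \<le> g z)}"

definition Gamma :: "('a::euclidean_space \<Rightarrow> ereal) set" where
  "Gamma = {g. proper g \<and> econvex g \<and> lower_semicont g}"

text \<open>Derivatives of a proper \<open>g\<close> at points of the interior of its domain, where \<open>g\<close> is finite,
  are those of \<open>\<lambda>y. real_of_ereal (g y)\<close>.\<close>

definition essentially_smooth :: "('a::euclidean_space \<Rightarrow> ereal) \<Rightarrow> bool" where
  "essentially_smooth g \<longleftrightarrow>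
     interior (edom g) \<noteq> {} \<and>
     (\<forall>y\<in>interior (edom g). (\<lambda>z. real_of_ereal (g z)) differentiable (at y)) \<and>
     (\<forall>Y y. (\<forall>k::nat. Y k \<in> interior (edom g)) \<and> Y \<longlonglongrightarrow> y \<and> y \<in> frontier (interior (edom g)) \<longrightarrow>
        filterlim (\<lambda>k. norm (gradient (\<lambda>z. real_of_ereal (g z)) (Y k))) at_top sequentially)"

definition essentially_strictly_convex :: "('a::euclidean_space \<Rightarrow> ereal) \<Rightarrow> bool" where
  "essentially_strictly_convex g \<longleftrightarrow>
     (\<forall>C. convex C \<and> C \<subseteq> {y. subdifferential g y \<noteq> {}} \<longrightarrow> strictly_econvex_on C g)"

definition Gamma_sc :: "('a::euclidean_space \<Rightarrow> ereal) set" where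
  "Gamma_sc = {g \<in> Gamma. essentially_smooth g \<and> essentially_strictly_convex g}"

definition Gamma_sc2 :: "(real^'m \<Rightarrow> ereal) set" where
  "Gamma_sc2 = {g \<in> Gamma_sc. \<forall>y\<in>interior (edom g).
      gradient (\<lambda>z. real_of_ereal (g z)) differentiable (at y) \<and>
      pos_definite (hessian (\<lambda>z. real_of_ereal (g z)) y)}"


section \<open>The primal and dual problems\<close>

text \<open>The index set \<open>{0,\<dots>,m}\<close> is the type \<open>'m option\<close>: \<open>None\<close> is the index \<open>0\<close> and
  the \<open>Some i\<close> are the indices \<open>1,\<dots>,m\<close>.\<close>

definition quad :: "real^'n^'n \<Rightarrow> real^'n \<Rightarrow> real \<Rightarrow> real^'n \<Rightarrow> real" where
  "quad M v r x = 1/2 * (x \<bullet> (M *v x)) - v \<bullet> x + r"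

definition qvec :: "('m option \<Rightarrow> real^'n^'n) \<Rightarrow> ('m option \<Rightarrow> real^'n) \<Rightarrow> ('m option \<Rightarrow> real)
    \<Rightarrow> real^'n \<Rightarrow> real^'m" where
  "qvec A b c x = (\<chi> i. quad (A (Some i)) (b (Some i)) (c (Some i)) x)"

definition primal :: "(real^'m \<Rightarrow> ereal) \<Rightarrow> ('m option \<Rightarrow> real^'n^'n) \<Rightarrow> ('m option \<Rightarrow> real^'n)
    \<Rightarrow> ('m option \<Rightarrow> real) \<Rightarrow> real^'n \<Rightarrow> ereal" where
  "primal V A b c x = ereal (quad (A None) (b None) (c None) x) + V (qvec A b c x)"

definition X0 :: "(real^'m \<Rightarrow> ereal) \<Rightarrow> ('m option \<Rightarrow> real^'n^'n) \<Rightarrow> ('m option \<Rightarrow> real^'n)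
    \<Rightarrow> ('m option \<Rightarrow> real) \<Rightarrow> (real^'n) set" where
  "X0 V A b c = {x. qvec A b c x \<in> interior (edom V)}"

definition coef :: "real^'m \<Rightarrow> 'm option \<Rightarrow> real" where
  "coef \<sigma> k = (case k of None \<Rightarrow> 1 | Some i \<Rightarrow> \<sigma> $ i)"

definition lincomb :: "('m::finite option \<Rightarrow> 'a::real_vector) \<Rightarrow> real^'m \<Rightarrow> 'a" where
  "lincomb a \<sigma> = (\<Sum>k\<in>UNIV. coef \<sigma> k *\<^sub>R a k)"

definition Xi :: "(real^'m \<Rightarrow> ereal) \<Rightarrow> ('m option \<Rightarrow> real^'n^'n) \<Rightarrow> ('m option \<Rightarrow> real^'n)
    \<Rightarrow> ('m option \<Rightarrow> real) \<Rightarrow> real^'n \<Rightarrow> real^'m \<Rightarrow> ereal" where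
  "Xi V A b c x \<sigma> =
     ereal (quad (A None) (b None) (c None) x + qvec A b c x \<bullet> \<sigma>) - fenchel_conj V \<sigma>"

definition critical_point_Xi :: "(real^'m \<Rightarrow> ereal) \<Rightarrow> ('m option \<Rightarrow> real^'n^'n)
    \<Rightarrow> ('m option \<Rightarrow> real^'n) \<Rightarrow> ('m option \<Rightarrow> real) \<Rightarrow> real^'n \<Rightarrow> real^'m \<Rightarrow> bool" where
  "critical_point_Xi V A b c x \<sigma> \<longleftrightarrow>
     \<sigma> \<in> interior (edom (fenchel_conj V)) \<and>
     (GDERIV (\<lambda>(y, \<tau>). real_of_ereal (Xi V A b c y \<tau>)) (x, \<sigma>) :> 0)"

definition S_col :: "(real^'m \<Rightarrow> ereal) \<Rightarrow> ('m option \<Rightarrow> real^'n^'n) \<Rightarrow> ('m option \<Rightarrow> real^'n)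
    \<Rightarrow> (real^'m) set" where
  "S_col V A b = {\<sigma> \<in> edom (fenchel_conj V). lincomb b \<sigma> \<in> range ((*v) (lincomb A \<sigma>))}"

definition S_neg :: "(real^'m \<Rightarrow> ereal) \<Rightarrow> ('m option \<Rightarrow> real^'n^'n) \<Rightarrow> (real^'m) set" where
  "S_neg V A = {\<sigma> \<in> edom (fenchel_conj V). neg_definite (lincomb A \<sigma>)}"

text \<open>For proper \<open>V\<close> the conjugate is finite on its domain, so \<open>Xi\<close> is finite there; the
  choice of \<open>x\<close> is immaterial by \<open>dual_eq\<close> below.\<close>

definition dual :: "(real^'m \<Rightarrow> ereal) \<Rightarrow> ('m option \<Rightarrow> real^'n^'n) \<Rightarrow> ('m option \<Rightarrow> real^'n)
    \<Rightarrow> ('m option \<Rightarrow> real) \<Rightarrow> real^'m \<Rightarrow> real" where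
  "dual V A b c \<sigma> =
     real_of_ereal (Xi V A b c (SOME x. lincomb A \<sigma> *v x = lincomb b \<sigma>) \<sigma>)"

lemma lincomb_eq: "lincomb a \<sigma> = a None + (\<Sum>i\<in>UNIV. (\<sigma> $ i) *\<^sub>R a (Some i))"
  by (simp add: lincomb_def coef_def UNIV_option_conv sum.reindex)

lemma transpose_lincomb:
  assumes "\<And>k. transpose (A k) = A k"
  shows "transpose (lincomb A \<sigma>) = lincomb A \<sigma>"
proof -
  have "A k $ i $ j = A k $ j $ i" for k i j
    using arg_cong[OF assms[of k], of "\<lambda>M. M $ j $ i"] by (simp add: transpose_def)
  then show ?thesis
    by (simp add: lincomb_def transpose_def vec_eq_iff)
qed

lemma Xi_eq:
  "Xi V A b c x \<sigma> =
     ereal (1/2 * (x \<bullet> (lincomb A \<sigma> *v x)) - lincomb b \<sigma> \<bullet> x + lincomb c \<sigma>) - fenchel_conj V \<sigma>"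
proof -
  have mv: "lincomb A \<sigma> *v x = A None *v x + (\<Sum>i\<in>UNIV. (\<sigma> $ i) *\<^sub>R (A (Some i) *v x))"
  proof -
    have "(\<Sum>i\<in>I. (\<sigma> $ i) *\<^sub>R A (Some i)) *v x = (\<Sum>i\<in>I. (\<sigma> $ i) *\<^sub>R (A (Some i) *v x))"
      if "finite I" for I
      using that
      by (induction I) (auto simp: matrix_vector_mult_add_rdistrib scaleR_matrix_vector_assoc)
    then show ?thesis
      by (simp add: lincomb_eq matrix_vector_mult_add_rdistrib)
  qed
  have "qvec A b c x \<bullet> \<sigma> = (\<Sum>i\<in>UNIV. \<sigma> $ i * quad (A (Some i)) (b (Some i)) (c (Some i)) x)"
    by (simp add: qvec_def inner_vec_def mult.commute)
  also have "\<dots> = (\<Sum>i\<in>UNIV. 1/2 * (\<sigma> $ i * (x \<bullet> (A (Some i) *v x)))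
      - \<sigma> $ i * (b (Some i) \<bullet> x) + \<sigma> $ i * c (Some i))"
    by (rule sum.cong) (auto simp: quad_def algebra_simps)
  also have "\<dots> = 1/2 * (\<Sum>i\<in>UNIV. \<sigma> $ i * (x \<bullet> (A (Some i) *v x)))
      - (\<Sum>i\<in>UNIV. \<sigma> $ i * (b (Some i) \<bullet> x)) + (\<Sum>i\<in>UNIV. \<sigma> $ i * c (Some i))"
    by (simp only: sum.distrib sum_subtractf sum_distrib_left)
  finally have q: "qvec A b c x \<bullet> \<sigma> = \<dots>" .
  have "x \<bullet> (lincomb A \<sigma> *v x) = x \<bullet> (A None *v x) + (\<Sum>i\<in>UNIV. \<sigma> $ i * (x \<bullet> (A (Some i) *v x)))"
    "lincomb b \<sigma> \<bullet> x = b None \<bullet> x + (\<Sum>i\<in>UNIV. \<sigma> $ i * (b (Some i) \<bullet> x))"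
    "lincomb c \<sigma> = c None + (\<Sum>i\<in>UNIV. \<sigma> $ i * c (Some i))"
    unfolding mv
    by (simp_all only: lincomb_eq inner_add_right inner_add_left inner_sum_right inner_sum_left
        inner_scaleR_right inner_scaleR_left real_scaleR_def)
  then have "quad (A None) (b None) (c None) x + qvec A b c x \<bullet> \<sigma> =
      1/2 * (x \<bullet> (lincomb A \<sigma> *v x)) - lincomb b \<sigma> \<bullet> x + lincomb c \<sigma>"
    unfolding q quad_def by argo
  then show ?thesis
    unfolding Xi_def by (simp only:)
qed

lemma dual_eq:
  assumes sym: "\<And>k. transpose (A k) = A k"
    and x: "lincomb A \<sigma> *v x = lincomb b \<sigma>"
  shows "dual V A b c \<sigma> = real_of_ereal (Xi V A b c x \<sigma>)"
proof -
  define y where "y = (SOME x. lincomb A \<sigma> *v x = lincomb b \<sigma>)"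
  have y: "lincomb A \<sigma> *v y = lincomb b \<sigma>"
    unfolding y_def using x by (rule someI)
  have "y \<bullet> (lincomb A \<sigma> *v x) = x \<bullet> (lincomb A \<sigma> *v y)"
    using dot_lmul_matrix[of y "lincomb A \<sigma>" x] transpose_matrix_vector[of "lincomb A \<sigma>" y]
    by (simp add: transpose_lincomb[OF sym] inner_commute)
  then have "y \<bullet> lincomb b \<sigma> = x \<bullet> lincomb b \<sigma>"
    using x y by simp
  then show ?thesis
    unfolding dual_def y_def[symmetric] Xi_eq x y by (simp add: inner_commute)
qed

end

theory Submission
  imports Defs "HOL-Library.Landau_Symbols"
begin

text \<open>Both equivalences are second-order tests. With \<open>J\<close> the Jacobian of \<open>q\<close> at \<open>x\<close> one has
  \<open>H = (E\<^sup>-\<^sup>1)\<^sup>* J\<^sup>* F\<^sup>*\<close> and \<open>\<nabla>\<^sup>2f(x) = A(\<sigma>) + J\<^sup>* F\<^sup>* F J = E\<^sup>* (H H\<^sup>* - I) E\<close>, while \<open>D\<close> has at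
  the critical point \<open>\<sigma>\<close> a second-order expansion with quadratic form
  \<open>- J A(\<sigma>)\<^sup>-\<^sup>1 J\<^sup>* - (F\<^sup>* F)\<^sup>-\<^sup>1 = F\<^sup>-\<^sup>1 (H\<^sup>* H - I) (F\<^sup>-\<^sup>1)\<^sup>*\<close>. Non-degeneracy of the first form
  passes to the second, and \<open>H\<close> is a strict contraction (for \<open>m = n\<close>: a strict expansion) iff
  \<open>H\<^sup>*\<close> is.

  The expansion of \<open>V\<^sup>*\<close> at \<open>\<sigma>\<close> is read off directly from that of \<open>V\<close> at \<open>q(x)\<close>: near \<open>q(x)\<close> the
  supremum defining \<open>V\<^sup>*\<close> is that of a perturbed quadratic, and convexity makes distant points
  irrelevant.\<close>

section \<open>Gradients and second-order expansions\<close>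

lemma GDERIV_imp_has_real_derivative_line:
  assumes "GDERIV f (x + t *\<^sub>R k) :> g"
  shows "((\<lambda>t. f (x + t *\<^sub>R k)) has_real_derivative (g \<bullet> k)) (at t)"
proof -
  have "((\<lambda>t. f (x + t *\<^sub>R k)) has_derivative (\<lambda>s. (s *\<^sub>R k) \<bullet> g)) (at t)"
    using assms unfolding gderiv_def
    by (rule has_derivative_compose[rotated]) (auto intro!: derivative_eq_intros)
  then show ?thesis
    by (rule has_derivative_imp_has_field_derivative) (simp add: inner_commute mult.commute)
qed

lemma GDERIV_partial:
  assumes "GDERIV (\<lambda>(y, t). f y t) (x, s) :> D"
  shows "GDERIV (\<lambda>y. f y s) x :> fst D" "GDERIV (\<lambda>t. f x t) s :> snd D"
proof -
  have f: "((\<lambda>p. f (fst p) (snd p)) has_derivative (\<lambda>h. h \<bullet> D)) (at (x, s))"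
    using assms by (simp add: gderiv_def case_prod_unfold)
  have "((\<lambda>y. (y, s)) has_derivative (\<lambda>h. (h, 0))) (at x)"
    by (intro has_derivative_Pair has_derivative_ident has_derivative_const)
  from has_derivative_compose[OF this f] show "GDERIV (\<lambda>y. f y s) x :> fst D"
    by (simp add: gderiv_def inner_prod_def)
  have "((\<lambda>t. (x, t)) has_derivative (\<lambda>h. (0, h))) (at s)"
    by (intro has_derivative_Pair has_derivative_ident has_derivative_const)
  from has_derivative_compose[OF this f] show "GDERIV (\<lambda>t. f x t) s :> snd D"
    by (simp add: gderiv_def inner_prod_def)
qed

lemma hessian_eqI:
  assumes "\<forall>\<^sub>F y in nhds x. GDERIV f y :> g y" and g: "(g has_derivative (*v) Q) (at x)"
  shows "hessian f x = Q"
proof -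
  have "\<forall>\<^sub>F y in nhds x. gradient f y = g y"
    using assms(1) by eventually_elim (rule gradient_eqI)
  then obtain S where S: "open S" "x \<in> S" "\<And>y. y \<in> S \<Longrightarrow> gradient f y = g y"
    unfolding eventually_nhds by blast
  have "(gradient f has_derivative (*v) Q) (at x)"
    using g S(1,2) by (rule has_derivative_transform_within_open) (simp add: S(3))
  moreover from this have "(gradient f has_derivative (*v) (hessian f x)) (at x)"
    unfolding hessian_def jacobian_works[symmetric] differentiable_def by blast
  ultimately have "(*v) (hessian f x) = (*v) Q"
    by (rule has_derivative_unique[rotated])
  then show ?thesis
    by (simp add: matrix_eq fun_eq_iff)
qed

definition has_quadratic_expansion ::
    "('a::real_inner \<Rightarrow> real) \<Rightarrow> 'a \<Rightarrow> 'a \<Rightarrow> ('a \<Rightarrow> 'a) \<Rightarrow> bool" where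
  "has_quadratic_expansion f x g L \<longleftrightarrow>
     (\<lambda>y. f y - f x - g \<bullet> (y - x) - ((y - x) \<bullet> L (y - x)) / 2) \<in> o[nhds x](\<lambda>y. (norm (y - x))\<^sup>2)"

lemma has_quadratic_expansion_iff:
  "has_quadratic_expansion f x g L \<longleftrightarrow> (\<forall>e>0. \<forall>\<^sub>F y in nhds x.
     \<bar>f y - f x - g \<bullet> (y - x) - ((y - x) \<bullet> L (y - x)) / 2\<bar> \<le> e * (norm (y - x))\<^sup>2)"
  unfolding has_quadratic_expansion_def smallo_def by simp

lemma has_quadratic_expansion_minus:
  assumes "has_quadratic_expansion f x g L"
  shows "has_quadratic_expansion (\<lambda>y. - f y) x (- g) (\<lambda>h. - L h)"
proof -
  have "- f y - - f x - (- g) \<bullet> (y - x) - ((y - x) \<bullet> - L (y - x)) / 2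
      = - (f y - f x - g \<bullet> (y - x) - ((y - x) \<bullet> L (y - x)) / 2)" for y
    by simp
  then show ?thesis
    using assms unfolding has_quadratic_expansion_def
    by (simp only: landau_o.small.uminus_in_iff)
qed

lemma GDERIV_quadratic_remainder_mvt:
  fixes f :: "'a::real_inner \<Rightarrow> real"
  assumes grad: "\<And>t. 0 \<le> t \<Longrightarrow> t \<le> 1 \<Longrightarrow> GDERIV f (x + t *\<^sub>R k) :> g (x + t *\<^sub>R k)"
  obtains t where "0 < t" "t < 1"
    "f (x + k) - f x - v \<bullet> k - (k \<bullet> w) / 2 = (g (x + t *\<^sub>R k) - v - t *\<^sub>R w) \<bullet> k"
proof -
  define p where "p t = f (x + t *\<^sub>R k) - t * (v \<bullet> k) - t\<^sup>2 / 2 * (k \<bullet> w)" for t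
  define p' where "p' t = g (x + t *\<^sub>R k) \<bullet> k - v \<bullet> k - t * (k \<bullet> w)" for t
  have "(p has_real_derivative p' t) (at t)" if t: "0 \<le> t" "t \<le> 1" for t
    unfolding p_def p'_def
    by (auto intro!: derivative_eq_intros GDERIV_imp_has_real_derivative_line[OF grad[OF t]])
  then have "\<exists>t::real. 0 < t \<and> t < 1 \<and> p 1 - p 0 = (1 - 0) * p' t"
    by (intro MVT2) auto
  then obtain t where "0 < t" "t < 1" "p 1 - p 0 = p' t" by auto
  then show thesis
    using that by (simp add: p_def p'_def inner_diff_left inner_commute[of w])
qed

lemma has_quadratic_expansion_gradient:
  fixes f :: "'a::real_inner \<Rightarrow> real"
  assumes grad: "\<forall>\<^sub>F y in nhds x. GDERIV f y :> g y" and L: "(g has_derivative L) (at x)"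
  shows "has_quadratic_expansion f x (g x) L"
  unfolding has_quadratic_expansion_iff
proof (intro allI impI)
  fix e :: real assume "e > 0"
  interpret bounded_linear L using L by (rule has_derivative_bounded_linear)
  obtain r where r: "r > 0" "\<And>y. dist y x < r \<Longrightarrow> GDERIV f y :> g y"
    using grad unfolding eventually_nhds_metric by blast
  obtain s where s: "s > 0"
    "\<And>y. norm (y - x) < s \<Longrightarrow> norm (g y - g x - L (y - x)) \<le> e * norm (y - x)"
    using L \<open>e > 0\<close> unfolding has_derivative_at_alt by blast
  have "\<bar>f y - f x - g x \<bullet> (y - x) - ((y - x) \<bullet> L (y - x)) / 2\<bar> \<le> e * (norm (y - x))\<^sup>2"
    if y: "dist y x < min r s" for y
  proof -
    let ?k = "y - x"
    have near: "norm (t *\<^sub>R ?k) \<le> norm ?k" if "0 \<le> t" "t \<le> 1" for t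
      using that by (simp add: mult_left_le_one_le)
    have "GDERIV f (x + t *\<^sub>R ?k) :> g (x + t *\<^sub>R ?k)" if "0 \<le> t" "t \<le> 1" for t
      using near[OF that] y by (intro r(2)) (simp add: dist_norm)
    then obtain t where t: "0 < t" "t < 1"
      "f (x + ?k) - f x - g x \<bullet> ?k - (?k \<bullet> L ?k) / 2 = (g (x + t *\<^sub>R ?k) - g x - t *\<^sub>R L ?k) \<bullet> ?k"
      by (rule GDERIV_quadratic_remainder_mvt)
    have "\<bar>(g (x + t *\<^sub>R ?k) - g x - t *\<^sub>R L ?k) \<bullet> ?k\<bar>
        \<le> norm (g (x + t *\<^sub>R ?k) - g x - t *\<^sub>R L ?k) * norm ?k"
      by (rule Cauchy_Schwarz_ineq2)
    also have "\<dots> \<le> (e * norm (t *\<^sub>R ?k)) * norm ?k"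
      using s(2)[of "x + t *\<^sub>R ?k"] near[of t] t y
      by (intro mult_right_mono) (simp_all add: scaleR dist_norm)
    also have "\<dots> \<le> (e * norm ?k) * norm ?k"
      using near[of t] t \<open>e > 0\<close> by (intro mult_right_mono mult_left_mono) auto
    finally show ?thesis
      using t by (simp add: power2_eq_square)
  qed
  then show "\<forall>\<^sub>F y in nhds x.
      \<bar>f y - f x - g x \<bullet> (y - x) - ((y - x) \<bullet> L (y - x)) / 2\<bar> \<le> e * (norm (y - x))\<^sup>2"
    unfolding eventually_nhds_metric using r(1) s(1) by (intro exI[of _ "min r s"]) auto
qed

section \<open>Second-order tests\<close>

lemma positive_form_lower_bound:
  fixes L :: "'a::euclidean_space \<Rightarrow> 'a"
  assumes "linear L" and pos: "\<And>h. h \<noteq> 0 \<Longrightarrow> h \<bullet> L h > 0"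
  obtains l where "l > 0" "\<And>h. l * (norm h)\<^sup>2 \<le> h \<bullet> L h"
proof -
  interpret linear L by fact
  have "continuous_on (sphere 0 1) (\<lambda>h. h \<bullet> L h)"
    by (intro continuous_intros linear_continuous_on) (simp add: linear_linear linear_axioms)
  then obtain k where k: "k \<in> sphere 0 1" "\<And>h. h \<in> sphere 0 1 \<Longrightarrow> k \<bullet> L k \<le> h \<bullet> L h"
    using continuous_attains_inf[of "sphere 0 1" "\<lambda>h. h \<bullet> L h"] by auto
  have "(k \<bullet> L k) * (norm h)\<^sup>2 \<le> h \<bullet> L h" for h
  proof (cases "h = 0")
    case False
    then have "k \<bullet> L k \<le> (h /\<^sub>R norm h) \<bullet> L (h /\<^sub>R norm h)"
      by (intro k) simp
    also have "\<dots> = (h \<bullet> L h) / (norm h)\<^sup>2"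
      by (simp add: scale power2_eq_square divide_simps)
    finally show ?thesis
      using False by (simp add: divide_simps)
  qed simp
  moreover have "k \<bullet> L k > 0"
    using k(1) by (intro pos) auto
  ultimately show thesis
    using that by blast
qed

lemma nonpositive_form_eq_0_imp_kernel:
  fixes L :: "'a::euclidean_space \<Rightarrow> 'a"
  assumes "linear L" "adjoint L = L" and nonpos: "\<And>h. h \<bullet> L h \<le> 0" and zero: "h \<bullet> L h = 0"
  shows "L h = 0"
proof -
  have sym: "h \<bullet> L k = k \<bullet> L h" for k
    using adjoint_works[OF assms(1), of h k] assms(2) by (simp add: inner_commute)
  have "((\<lambda>k. k \<bullet> L k) has_derivative (\<lambda>k. h \<bullet> L k + k \<bullet> L h)) (at h)"
    using assms(1)
    by (intro has_derivative_inner has_derivative_ident linear_imp_has_derivative)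
  then have "(\<lambda>k. h \<bullet> L k + k \<bullet> L h) = (\<lambda>k. 0)"
    by (rule differential_zero_maxmin[OF UNIV_I open_UNIV]) (use nonpos zero in auto)
  then have "L h \<bullet> L h = 0"
    using sym[of "L h"] by (metis double_zero)
  then show ?thesis by simp
qed

lemma mem_interior_iff_eventually_nhds: "x \<in> interior S \<longleftrightarrow> (\<forall>\<^sub>F y in nhds x. y \<in> S)"
  by (auto simp: interior_def eventually_nhds)

lemma
  assumes "x \<in> interior S"
  shows local_maximizer_on_iff_eventually:
      "local_maximizer_on S f x \<longleftrightarrow> (\<forall>\<^sub>F y in nhds x. f y \<le> f x)"
    and local_minimizer_on_iff_eventually:
      "local_minimizer_on S f x \<longleftrightarrow> (\<forall>\<^sub>F y in nhds x. f x \<le> f y)"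
proof -
  have "\<forall>\<^sub>F y in nhds x. y \<in> S"
    using assms by (simp add: mem_interior_iff_eventually_nhds)
  then have "(\<forall>\<^sub>F y in nhds x. P y) \<longleftrightarrow> (\<forall>\<^sub>F y in nhds x. y \<in> S \<longrightarrow> P y)" for P
    by (auto elim: eventually_elim2)
  moreover have "(\<forall>\<^sub>F y in nhds x. y \<in> S \<longrightarrow> P y) \<longleftrightarrow> (\<exists>e>0. \<forall>y\<in>S \<inter> ball x e. P y)" for P
    unfolding eventually_nhds_metric by (auto simp: dist_commute)
  moreover have "x \<in> S"
    using assms interior_subset by blast
  ultimately show "local_maximizer_on S f x \<longleftrightarrow> (\<forall>\<^sub>F y in nhds x. f y \<le> f x)"
    "local_minimizer_on S f x \<longleftrightarrow> (\<forall>\<^sub>F y in nhds x. f x \<le> f y)"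
    by (simp_all add: local_maximizer_on_def local_minimizer_on_def)
qed

lemma
  assumes x: "x \<in> interior S" and finite: "\<forall>\<^sub>F y in nhds x. g y = ereal (f y)"
  shows local_maximizer_on_ereal_iff: "local_maximizer_on S g x \<longleftrightarrow> local_maximizer_on S f x"
    and local_minimizer_on_ereal_iff: "local_minimizer_on S g x \<longleftrightarrow> local_minimizer_on S f x"
  unfolding local_maximizer_on_iff_eventually[OF x] local_minimizer_on_iff_eventually[OF x]
    eventually_nhds_x_imp_x[OF finite]
  by (rule eventually_cong[OF finite], simp)+

lemma quadratic_expansion_local_max_imp_nonpositive:
  fixes f :: "'a::real_inner \<Rightarrow> real"
  assumes f: "has_quadratic_expansion f x 0 L" and "linear L"
    and max: "\<forall>\<^sub>F y in nhds x. f y \<le> f x"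
  shows "h \<bullet> L h \<le> 0"
proof (rule ccontr)
  interpret linear L by fact
  assume "\<not> h \<bullet> L h \<le> 0"
  then have pos: "h \<bullet> L h > 0" and "h \<noteq> 0" by auto
  define e where "e = (h \<bullet> L h) / (4 * (norm h)\<^sup>2)"
  have e: "e > 0" "e * (norm h)\<^sup>2 = (h \<bullet> L h) / 4"
    using pos \<open>h \<noteq> 0\<close> by (simp_all add: e_def)
  have "\<forall>\<^sub>F y in nhds x. ((y - x) \<bullet> L (y - x)) / 2 \<le> e * (norm (y - x))\<^sup>2"
    using max f[unfolded has_quadratic_expansion_iff, rule_format, OF e(1)]
    by eventually_elim (simp add: abs_le_iff)
  moreover have "((\<lambda>t. x + t *\<^sub>R h) \<longlongrightarrow> x) (at_right 0)"
    by (auto intro!: tendsto_eq_intros)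
  ultimately have "\<forall>\<^sub>F t in at_right 0. ((t *\<^sub>R h) \<bullet> L (t *\<^sub>R h)) / 2 \<le> e * (norm (t *\<^sub>R h))\<^sup>2"
    by (auto dest: eventually_compose_filterlim)
  then have "\<forall>\<^sub>F t in at_right (0::real). False"
    using eventually_at_right_less[of 0]
  proof eventually_elim
    case (elim t)
    then have "t\<^sup>2 * ((h \<bullet> L h) / 2) \<le> t\<^sup>2 * (e * (norm h)\<^sup>2)"
      by (simp add: scale power_mult_distrib power2_eq_square mult_ac)
    then show False
      using elim(2) pos unfolding e(2) by simp
  qed
  then show False by simp
qed

lemma quadratic_expansion_negative_imp_local_max:
  fixes f :: "'a::euclidean_space \<Rightarrow> real"
  assumes f: "has_quadratic_expansion f x 0 L" and "linear L"
    and neg: "\<And>h. h \<noteq> 0 \<Longrightarrow> h \<bullet> L h < 0"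
  shows "\<forall>\<^sub>F y in nhds x. f y \<le> f x"
proof -
  have "linear (\<lambda>h. - L h)"
    using \<open>linear L\<close> by (rule linear_compose_neg)
  then obtain l where l: "l > 0" "\<And>h. l * (norm h)\<^sup>2 \<le> h \<bullet> - L h"
    using positive_form_lower_bound[of "\<lambda>h. - L h"] neg by auto
  have "\<forall>\<^sub>F y in nhds x.
      \<bar>f y - f x - 0 \<bullet> (y - x) - ((y - x) \<bullet> L (y - x)) / 2\<bar> \<le> l / 2 * (norm (y - x))\<^sup>2"
    using l(1) by (intro f[unfolded has_quadratic_expansion_iff, rule_format]) simp
  then show ?thesis
  proof eventually_elim
    case (elim y)
    then show ?case
      using l(2)[of "y - x"] unfolding inner_zero_left inner_minus_right by linarith
  qed
qed

theorem local_maximizer_on_iff_negative_form: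
  fixes f :: "'a::euclidean_space \<Rightarrow> real"
  assumes "has_quadratic_expansion f x 0 L" "x \<in> interior S"
    and "linear L" "adjoint L = L" and "inj L"
  shows "local_maximizer_on S f x \<longleftrightarrow> (\<forall>h. h \<noteq> 0 \<longrightarrow> h \<bullet> L h < 0)"
  unfolding local_maximizer_on_iff_eventually[OF assms(2)]
proof
  assume "\<forall>\<^sub>F y in nhds x. f y \<le> f x"
  with assms(1,3) have nonpos: "h \<bullet> L h \<le> 0" for h
    by (rule quadratic_expansion_local_max_imp_nonpositive)
  have "h = 0" if "h \<bullet> L h = 0" for h
    using nonpositive_form_eq_0_imp_kernel[OF assms(3,4) nonpos that] assms(3,5)
    by (simp add: linear_injective_0)
  with nonpos show "\<forall>h. h \<noteq> 0 \<longrightarrow> h \<bullet> L h < 0"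
    by (metis order_le_less)
next
  assume "\<forall>h. h \<noteq> 0 \<longrightarrow> h \<bullet> L h < 0"
  then show "\<forall>\<^sub>F y in nhds x. f y \<le> f x"
    using quadratic_expansion_negative_imp_local_max[OF assms(1,3)] by blast
qed

corollary local_minimizer_on_iff_positive_form:
  fixes f :: "'a::euclidean_space \<Rightarrow> real"
  assumes "has_quadratic_expansion f x 0 L" "x \<in> interior S"
    and "linear L" "adjoint L = L" and "inj L"
  shows "local_minimizer_on S f x \<longleftrightarrow> (\<forall>h. h \<noteq> 0 \<longrightarrow> h \<bullet> L h > 0)"
proof -
  have "adjoint (\<lambda>h. - L h) = (\<lambda>h. - L h)"
    using adjoint_works[OF assms(3)] assms(4) by (intro adjoint_unique) (simp add: inner_commute)
  then show ?thesis
    using local_maximizer_on_iff_negative_form[of "\<lambda>y. - f y" x "\<lambda>h. - L h" S] assms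
      has_quadratic_expansion_minus[OF assms(1)]
    by (simp add: local_minimizer_on_def local_maximizer_on_def linear_compose_neg inj_on_def)
qed

section \<open>Convex conjugates\<close>

lemma proper_eq_ereal:
  assumes "proper g" "y \<in> edom g"
  shows "g y = ereal (real_of_ereal (g y))"
  using assms by (cases "g y") (auto simp: proper_def edom_def)

lemma econvex_chord:
  assumes "econvex g" "g y = ereal v" "g z = ereal w" "0 < u" "u < 1"
  shows "g (y + u *\<^sub>R (z - y)) \<le> ereal (v + u * (w - v))"
proof -
  have "g (y + u *\<^sub>R (z - y)) = g ((1 - u) *\<^sub>R y + u *\<^sub>R z)"
    by (simp add: algebra_simps)
  also have "\<dots> \<le> ereal (1 - u) * g y + ereal u * g z"
    using assms(1,4,5) unfolding econvex_def by blast
  also have "\<dots> = ereal (v + u * (w - v))"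
    by (simp add: assms algebra_simps)
  finally show ?thesis .
qed

lemma econvex_gradient_in_subdifferential:
  fixes g :: "'a::euclidean_space \<Rightarrow> ereal"
  assumes g: "proper g" "econvex g" and y: "y \<in> edom g"
    and grad: "GDERIV (\<lambda>z. real_of_ereal (g z)) y :> s"
  shows "s \<in> subdifferential g y"
proof -
  let ?r = "\<lambda>z. real_of_ereal (g z)"
  obtain v where v: "g y = ereal v"
    using proper_eq_ereal[OF g(1) y] ..
  have "ereal (v + (z - y) \<bullet> s) \<le> g z" for z
  proof (cases "g z")
    case (real w)
    define p where "p u = ?r (y + u *\<^sub>R (z - y)) - u * (w - v)" for u
    have chord: "p u \<le> p 0" if "0 < u" "u < 1" for u
      using econvex_chord[OF g(2) v real that] g(1)
      by (cases "g (y + u *\<^sub>R (z - y))") (auto simp: p_def v proper_def)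
    have "((\<lambda>u. ?r (y + u *\<^sub>R (z - y))) has_real_derivative (s \<bullet> (z - y))) (at 0)"
      using grad by (intro GDERIV_imp_has_real_derivative_line) simp
    then have "(p has_real_derivative (s \<bullet> (z - y) - (w - v))) (at 0)"
      unfolding p_def by (auto intro!: derivative_eq_intros)
    moreover have "\<exists>h>0. h < d \<and> p (0 + h) \<le> p 0" if "d > 0" for d
      using that chord[of "min d 1 / 2"] by (intro exI[of _ "min d 1 / 2"]) auto
    ultimately have "s \<bullet> (z - y) - (w - v) \<le> 0"
      using DERIV_pos_inc_right[of p _ 0] by (meson not_le)
    then show ?thesis
      by (simp add: real inner_commute)
  qed (use g(1) in \<open>auto simp: proper_def\<close>)
  then show ?thesis
    by (simp add: subdifferential_def v)
qed

lemma subdifferential_eq_gradient: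
  fixes g :: "'a::euclidean_space \<Rightarrow> ereal"
  assumes g: "proper g" and y: "y \<in> interior (edom g)"
    and grad: "GDERIV (\<lambda>z. real_of_ereal (g z)) y :> t" and s: "s \<in> subdifferential g y"
  shows "s = t"
proof -
  let ?r = "\<lambda>z. real_of_ereal (g z)"
  have min: "?r y - y \<bullet> s \<le> ?r z - z \<bullet> s" if "z \<in> interior (edom g)" for z
  proof -
    have "y \<in> edom g" "z \<in> edom g"
      using y that interior_subset by blast+
    moreover have "g y + ereal ((z - y) \<bullet> s) \<le> g z"
      using s by (simp add: subdifferential_def)
    ultimately show ?thesis
      using g by (cases "g y"; cases "g z") (auto simp: inner_diff_left proper_def edom_def)
  qed
  have "((\<lambda>z. ?r z - z \<bullet> s) has_derivative (\<lambda>h. h \<bullet> t - h \<bullet> s)) (at y)"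
    using grad unfolding gderiv_def by (auto intro!: derivative_eq_intros)
  then have "(\<lambda>h. h \<bullet> t - h \<bullet> s) = (\<lambda>h. 0)"
    by (rule differential_zero_maxmin[OF y open_interior]) (use min in blast)
  then have "(t - s) \<bullet> (t - s) = 0"
    unfolding inner_diff_right by meson
  then show ?thesis by simp
qed

lemma fenchel_conj_upper: "ereal (y \<bullet> s) - V y \<le> fenchel_conj V s"
  unfolding fenchel_conj_def by (rule SUP_upper) simp

lemma fenchel_conj_le_iff:
  "fenchel_conj V s \<le> ereal w \<longleftrightarrow> (\<forall>y. ereal (y \<bullet> s - w) \<le> V y)"
proof -
  have "ereal (y \<bullet> s) - V y \<le> ereal w \<longleftrightarrow> ereal (y \<bullet> s - w) \<le> V y" for y
    by (cases "V y") auto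
  then show ?thesis
    by (simp add: fenchel_conj_def SUP_le_iff)
qed

lemma proper_fenchel_conj:
  assumes "proper V" "s \<in> edom (fenchel_conj V)"
  shows "proper (fenchel_conj V)"
proof -
  obtain y where "V y < \<infinity>" "V y > -\<infinity>"
    using assms(1) by (auto simp: proper_def edom_def)
  then have "ereal (y \<bullet> t) - V y > -\<infinity>" for t
    by (cases "V y") auto
  then show ?thesis
    unfolding proper_def using assms(2) fenchel_conj_upper less_le_trans by blast
qed

lemma econvex_fenchel_conj:
  fixes V :: "'a::real_inner \<Rightarrow> ereal"
  assumes "proper V"
  shows "econvex (fenchel_conj V)"
  unfolding econvex_def
proof (intro allI impI)
  fix s t :: 'a and u :: real assume u: "0 < u \<and> u < 1"
  let ?w = "(1 - u) *\<^sub>R s + u *\<^sub>R t"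
  have "ereal (y \<bullet> ?w) - V y \<le> ereal (1 - u) * fenchel_conj V s + ereal u * fenchel_conj V t" for y
  proof (cases "V y")
    case (real v)
    have "ereal (y \<bullet> s - v) \<le> fenchel_conj V s" "ereal (y \<bullet> t - v) \<le> fenchel_conj V t"
      using fenchel_conj_upper[of y _ V] by (auto simp: real)
    then have "ereal (1 - u) * ereal (y \<bullet> s - v) + ereal u * ereal (y \<bullet> t - v)
        \<le> ereal (1 - u) * fenchel_conj V s + ereal u * fenchel_conj V t"
      using u by (intro add_mono ereal_mult_left_mono) auto
    then show ?thesis
      by (simp add: real inner_add_right algebra_simps)
  qed (use assms in \<open>auto simp: proper_def\<close>)
  then show "fenchel_conj V ?w \<le> ereal (1 - u) * fenchel_conj V s + ereal u * fenchel_conj V t"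
    unfolding fenchel_conj_def[of V ?w] by (rule SUP_least)
qed

lemma fenchel_young_iff:
  assumes "V y = ereal v"
  shows "s \<in> subdifferential V y \<longleftrightarrow> fenchel_conj V s \<le> ereal (y \<bullet> s - v)"
  unfolding fenchel_conj_le_iff subdifferential_def
  by (simp add: assms inner_diff_left algebra_simps)

lemma subdifferential_fenchel_conjD:
  assumes conj: "y \<in> subdifferential (fenchel_conj V) s" and "t \<in> subdifferential V y"
  shows "s \<in> subdifferential V y"
proof -
  obtain v w where v: "V y = ereal v" and w: "fenchel_conj V s = ereal w"
    using assms by (cases "V y"; cases "fenchel_conj V s") (auto simp: subdifferential_def)
  have "ereal (w + (t - s) \<bullet> y) \<le> fenchel_conj V t"
    using conj by (simp add: subdifferential_def w)
  also have "\<dots> \<le> ereal (y \<bullet> t - v)"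
    using assms(2) fenchel_young_iff[of V y v, OF v] by blast
  finally have "w \<le> y \<bullet> s - v"
    by (simp add: inner_commute[of y] inner_diff_left)
  then show ?thesis
    by (simp add: fenchel_young_iff[of V y v, OF v] w)
qed

theorem gradient_eq_if_gradient_fenchel_conj:
  fixes V :: "'a::euclidean_space \<Rightarrow> ereal"
  assumes V: "proper V" "econvex V"
    and y: "y \<in> interior (edom V)" and s: "s \<in> edom (fenchel_conj V)"
    and grad: "GDERIV (\<lambda>z. real_of_ereal (V z)) y :> t"
    and grad_conj: "GDERIV (\<lambda>z. real_of_ereal (fenchel_conj V z)) s :> y"
  shows "t = s"
proof -
  have "proper (fenchel_conj V)"
    using V(1) s by (rule proper_fenchel_conj)
  then have "y \<in> subdifferential (fenchel_conj V) s"
    using econvex_fenchel_conj[OF V(1)] s grad_conj by (rule econvex_gradient_in_subdifferential)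
  moreover have "t \<in> subdifferential V y"
    using V y grad interior_subset by (blast intro: econvex_gradient_in_subdifferential)
  ultimately have "s \<in> subdifferential V y"
    by (rule subdifferential_fenchel_conjD)
  then show ?thesis
    using subdifferential_eq_gradient[OF V(1) y grad] by simp
qed

lemma econvex_linear_growth:
  fixes V :: "'a::real_normed_vector \<Rightarrow> ereal"
  assumes V: "econvex V" "V y = ereal v" and low: "V (y + k) > -\<infinity>"
    and lin: "linear \<phi>" and d: "0 < d" "d \<le> norm k"
    and sphere: "\<And>k. norm k = d \<Longrightarrow> ereal (v + \<phi> k + a) \<le> V (y + k)"
  shows "ereal (v + \<phi> k + a * norm k / d) \<le> V (y + k)"
proof (cases "norm k = d")
  case False
  define t where "t = d / norm k"
  have "d < norm k" "k \<noteq> 0"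
    using d False by auto
  then have t: "0 < t" "t < 1" "a * norm k / d = a / t"
    using d(1) by (auto simp: t_def divide_simps)
  have lower: "ereal (v + t * \<phi> k + a) \<le> V (y + t *\<^sub>R (y + k - y))"
    using sphere[of "t *\<^sub>R k"] t(1) d(1) \<open>k \<noteq> 0\<close> by (simp add: t_def linear_scale[OF lin])
  have "ereal (v + t * \<phi> k + a) \<le> ereal (v + t * (w - v))" if "V (y + k) = ereal w" for w
    using lower econvex_chord[OF V that t(1,2)] by (rule order_trans)
  then show ?thesis
    using t(1) low unfolding t(3)
    by (cases "V (y + k)") (auto simp: field_simps)
qed (use sphere d in simp)

lemma norm_add_power2_le: "(norm (a + b))\<^sup>2 \<le> 2 * (norm a)\<^sup>2 + 2 * (norm b)\<^sup>2"
  for a b :: "'a::real_inner"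
proof -
  have "(norm (a + b))\<^sup>2 + (norm (a - b))\<^sup>2 = 2 * (norm a)\<^sup>2 + 2 * (norm b)\<^sup>2"
    by (simp add: power2_norm_eq_inner inner_diff inner_add inner_commute)
  then show ?thesis
    by (smt (verit) zero_le_power2)
qed

lemma perturbed_quadratic_conj_le:
  fixes W :: "'a::euclidean_space \<Rightarrow> 'a"
  assumes W: "linear W" "adjoint W = W" and coercive: "\<And>h. l * (norm h)\<^sup>2 \<le> h \<bullet> W h"
    and e: "0 \<le> e" "4 * e \<le> l"
  shows "k \<bullet> W u - ((k \<bullet> W k) / 2 - e * (norm k)\<^sup>2) \<le> (u \<bullet> W u) / 2 + 2 * e * (norm u)\<^sup>2"
proof -
  interpret linear W by fact
  have sym: "u \<bullet> W k = k \<bullet> W u"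
    using adjoint_works[OF W(1), of u k] W(2) by (simp add: inner_commute)
  have square: "k \<bullet> W u - (k \<bullet> W k) / 2 = (u \<bullet> W u) / 2 - ((k - u) \<bullet> W (k - u)) / 2"
    by (simp add: diff inner_diff sym field_simps)
  have "4 * (e * (norm (k - u))\<^sup>2) \<le> (k - u) \<bullet> W (k - u)"
    using mult_right_mono[OF e(2), of "(norm (k - u))\<^sup>2"] coercive[of "k - u"] by simp
  moreover have "e * (norm k)\<^sup>2 \<le> 2 * (e * (norm (k - u))\<^sup>2) + 2 * (e * (norm u)\<^sup>2)"
    using mult_left_mono[OF norm_add_power2_le[of "k - u" u] e(1)] by (simp add: algebra_simps)
  ultimately show ?thesis
    using square unfolding mult.assoc by linarith
qed

lemma fenchel_conj_le_if_quadratic_minorant: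
  fixes V :: "'a::euclidean_space \<Rightarrow> ereal"
  assumes V: "proper V" "econvex V" "V y = ereal v"
    and W: "linear W" "adjoint W = W" and l: "l > 0" "\<And>h. l * (norm h)\<^sup>2 \<le> h \<bullet> W h"
    and e: "0 \<le> e" "4 * e \<le> l" and "d > 0"
    and minorant: "\<And>k. norm k \<le> d \<Longrightarrow>
      ereal (v + s \<bullet> k + ((k \<bullet> W k) / 2 - e * (norm k)\<^sup>2)) \<le> V (y + k)"
    and u: "norm (W u) \<le> l * d / 4"
  shows "fenchel_conj V (s + W u)
    \<le> ereal (y \<bullet> (s + W u) - v + ((u \<bullet> W u) / 2 + 2 * e * (norm u)\<^sup>2))"
  unfolding fenchel_conj_le_iff
proof
  fix z
  define k where "k = z - y"
  let ?q = "(u \<bullet> W u) / 2 + 2 * e * (norm u)\<^sup>2"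
  have "ereal (v + s \<bullet> k + (k \<bullet> W u - ?q)) \<le> V (y + k)"
  proof (cases "norm k \<le> d")
    case True
    have "k \<bullet> W u - ?q \<le> (k \<bullet> W k) / 2 - e * (norm k)\<^sup>2"
      using perturbed_quadratic_conj_le[OF W l(2) e, of k u] by simp
    then show ?thesis
      using minorant[OF True] by (elim order_trans[rotated]) simp
  next
    case False
    have sphere: "ereal (v + s \<bullet> k + l * d\<^sup>2 / 4) \<le> V (y + k)" if "norm k = d" for k
    proof -
      have "l * d\<^sup>2 / 4 \<le> (k \<bullet> W k) / 2 - e * (norm k)\<^sup>2"
        using l(2)[of k] mult_right_mono[OF e(2), of "d\<^sup>2"] that by simp
      then show ?thesis
        using that by (intro order_trans[OF _ minorant]) simp_all
    qed
    have "linear ((\<bullet>) s)"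
      by (rule bounded_linear.linear[OF bounded_linear_inner_right])
    then have "ereal (v + s \<bullet> k + l * d\<^sup>2 / 4 * norm k / d) \<le> V (y + k)"
      using V(1) False sphere \<open>d > 0\<close>
      by (intro econvex_linear_growth[OF V(2,3)]) (auto simp: proper_def)
    moreover have "k \<bullet> W u \<le> norm k * (l * d / 4)"
      using u by (intro order_trans[OF norm_cauchy_schwarz] mult_left_mono) auto
    moreover have "0 \<le> u \<bullet> W u"
      using l(1) order_trans[OF _ l(2)[of u]] by simp
    moreover have "0 \<le> e * (norm u)\<^sup>2"
      using e(1) by simp
    ultimately show ?thesis
      using \<open>d > 0\<close> by (elim order_trans[rotated]) (simp add: power2_eq_square algebra_simps)
  qed
  then show "ereal (z \<bullet> (s + W u) - (y \<bullet> (s + W u) - v + ?q)) \<le> V z"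
    by (simp add: k_def inner_diff inner_add inner_commute[of s] algebra_simps)
qed

lemma fenchel_conj_ge_if_quadratic_majorant:
  assumes "V (y + u) \<le> ereal (v + s \<bullet> u + ((u \<bullet> W u) / 2 + e * (norm u)\<^sup>2))"
  shows "ereal (y \<bullet> (s + W u) - v + ((u \<bullet> W u) / 2 - e * (norm u)\<^sup>2)) \<le> fenchel_conj V (s + W u)"
proof -
  have "ereal (y \<bullet> (s + W u) - v + ((u \<bullet> W u) / 2 - e * (norm u)\<^sup>2))
      \<le> ereal ((y + u) \<bullet> (s + W u)) - V (y + u)"
    using assms by (cases "V (y + u)") (auto simp: inner_add inner_commute[of s] algebra_simps)
  then show ?thesis
    using fenchel_conj_upper by (rule order_trans)
qed

lemma has_quadratic_expansion_ereal_bounds: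
  fixes V :: "'a::real_inner \<Rightarrow> ereal"
  assumes V: "proper V" "V y = ereal v" and y: "y \<in> interior (edom V)"
    and expansion: "has_quadratic_expansion (\<lambda>z. real_of_ereal (V z)) y s W" and "e > 0"
  obtains d where "d > 0"
    "\<And>k. norm k \<le> d \<Longrightarrow> ereal (v + s \<bullet> k + ((k \<bullet> W k) / 2 - e * (norm k)\<^sup>2)) \<le> V (y + k)"
    "\<And>k. norm k \<le> d \<Longrightarrow> V (y + k) \<le> ereal (v + s \<bullet> k + ((k \<bullet> W k) / 2 + e * (norm k)\<^sup>2))"
proof -
  let ?r = "\<lambda>z. real_of_ereal (V z)"
  have "\<forall>\<^sub>F z in nhds y. z \<in> edom V"
    using y by (simp add: mem_interior_iff_eventually_nhds)
  with expansion[unfolded has_quadratic_expansion_iff, rule_format, OF \<open>e > 0\<close>]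
  have "\<forall>\<^sub>F z in nhds y. \<bar>?r z - ?r y - s \<bullet> (z - y) - ((z - y) \<bullet> W (z - y)) / 2\<bar>
      \<le> e * (norm (z - y))\<^sup>2 \<and> z \<in> edom V"
    by (rule eventually_conj)
  then obtain d where d: "d > 0" "\<And>z. dist z y < d \<Longrightarrow>
      \<bar>?r z - ?r y - s \<bullet> (z - y) - ((z - y) \<bullet> W (z - y)) / 2\<bar> \<le> e * (norm (z - y))\<^sup>2 \<and> z \<in> edom V"
    unfolding eventually_nhds_metric by blast
  have near: "\<bar>?r (y + k) - v - s \<bullet> k - (k \<bullet> W k) / 2\<bar> \<le> e * (norm k)\<^sup>2"
      "V (y + k) = ereal (?r (y + k))"
    if "norm k \<le> d / 2" for k
    using d(1) d(2)[of "y + k"] that V(2) proper_eq_ereal[OF V(1), of "y + k"]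
    by (simp_all add: dist_norm)
  show thesis
  proof (rule that[of "d / 2"])
    fix k :: 'a assume k: "norm k \<le> d / 2"
    show "ereal (v + s \<bullet> k + ((k \<bullet> W k) / 2 - e * (norm k)\<^sup>2)) \<le> V (y + k)"
      "V (y + k) \<le> ereal (v + s \<bullet> k + ((k \<bullet> W k) / 2 + e * (norm k)\<^sup>2))"
      using near(1)[OF k] by (subst near(2)[OF k], simp add: abs_le_iff)+
  qed (use d(1) in simp)
qed

lemma quadratic_expansion_fenchel_conj_sandwich:
  fixes V :: "'a::euclidean_space \<Rightarrow> ereal"
  assumes V: "proper V" "econvex V" and y: "y \<in> interior (edom V)"
    and expansion: "has_quadratic_expansion (\<lambda>z. real_of_ereal (V z)) y s W"
    and W: "linear W" "adjoint W = W" and l: "l > 0" "\<And>h. l * (norm h)\<^sup>2 \<le> h \<bullet> W h"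
    and e: "0 < e" "4 * e \<le> l"
  obtains d where "d > 0"
    "\<And>u. norm u \<le> d \<Longrightarrow> norm (W u) \<le> d \<Longrightarrow> \<exists>w. fenchel_conj V (s + W u) = ereal w \<and>
       \<bar>w - (y \<bullet> (s + W u) - real_of_ereal (V y) + (u \<bullet> W u) / 2)\<bar> \<le> 2 * e * (norm u)\<^sup>2"
proof -
  obtain v where v: "V y = ereal v"
    using proper_eq_ereal[OF V(1) subsetD[OF interior_subset y]] ..
  obtain \<delta> where \<delta>: "\<delta> > 0"
    "\<And>k. norm k \<le> \<delta> \<Longrightarrow> ereal (v + s \<bullet> k + ((k \<bullet> W k) / 2 - e * (norm k)\<^sup>2)) \<le> V (y + k)"
    "\<And>k. norm k \<le> \<delta> \<Longrightarrow> V (y + k) \<le> ereal (v + s \<bullet> k + ((k \<bullet> W k) / 2 + e * (norm k)\<^sup>2))"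
    using has_quadratic_expansion_ereal_bounds[OF V(1) v y expansion e(1)] by blast
  define d where "d = min \<delta> (l * \<delta> / 4)"
  have "\<exists>w. fenchel_conj V (s + W u) = ereal w \<and>
       \<bar>w - (y \<bullet> (s + W u) - real_of_ereal (V y) + (u \<bullet> W u) / 2)\<bar> \<le> 2 * e * (norm u)\<^sup>2"
    if u: "norm u \<le> d" "norm (W u) \<le> d" for u
  proof -
    have "fenchel_conj V (s + W u)
        \<le> ereal (y \<bullet> (s + W u) - v + ((u \<bullet> W u) / 2 + 2 * e * (norm u)\<^sup>2))"
      using e(1) u(2)
      by (intro fenchel_conj_le_if_quadratic_minorant[OF V v W l _ e(2) \<delta>(1,2)])
        (simp_all add: d_def)
    moreover have "ereal (y \<bullet> (s + W u) - v + ((u \<bullet> W u) / 2 - e * (norm u)\<^sup>2))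
        \<le> fenchel_conj V (s + W u)"
      using \<delta>(3)[of u] u(1) by (intro fenchel_conj_ge_if_quadratic_majorant) (simp add: d_def)
    moreover have "0 \<le> e * (norm u)\<^sup>2"
      using e(1) by simp
    ultimately show ?thesis
      by (cases "fenchel_conj V (s + W u)") (auto simp: v abs_le_iff)
  qed
  moreover have "d > 0"
    using \<delta>(1) l(1) by (simp add: d_def)
  ultimately show thesis
    using that by blast
qed

theorem has_quadratic_expansion_fenchel_conj:
  fixes V :: "'a::euclidean_space \<Rightarrow> ereal"
  assumes V: "proper V" "econvex V" and y: "y \<in> interior (edom V)"
    and expansion: "has_quadratic_expansion (\<lambda>z. real_of_ereal (V z)) y s W"
    and W: "linear W" "adjoint W = W" "\<And>h. h \<noteq> 0 \<Longrightarrow> h \<bullet> W h > 0"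
    and R: "linear R" "\<And>h. W (R h) = h"
  shows "has_quadratic_expansion (\<lambda>t. real_of_ereal (fenchel_conj V t)) s y R"
  unfolding has_quadratic_expansion_iff
proof (intro allI impI)
  fix e :: real assume "e > 0"
  interpret R: linear R by fact
  obtain l where l: "l > 0" "\<And>h. l * (norm h)\<^sup>2 \<le> h \<bullet> W h"
    using positive_form_lower_bound[OF W(1,3)] by blast
  obtain K where K: "K > 0" "\<And>h. norm (R h) \<le> K * norm h"
    using linear_bounded_pos[OF R(1)] by blast
  define \<epsilon> where "\<epsilon> = min (l / 4) (e / (2 * K\<^sup>2))"
  have \<epsilon>: "\<epsilon> > 0" "4 * \<epsilon> \<le> l" "2 * \<epsilon> * K\<^sup>2 \<le> e"
    using l(1) K(1) \<open>e > 0\<close> by (auto simp: \<epsilon>_def min_def field_simps)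
  let ?C = "\<lambda>t. real_of_ereal (fenchel_conj V t)" and ?r = "\<lambda>z. real_of_ereal (V z)"
  obtain d where d: "d > 0"
    "\<And>u. norm u \<le> d \<Longrightarrow> norm (W u) \<le> d \<Longrightarrow>
       \<bar>?C (s + W u) - (y \<bullet> (s + W u) - ?r y + (u \<bullet> W u) / 2)\<bar> \<le> 2 * \<epsilon> * (norm u)\<^sup>2"
    by (rule quadratic_expansion_fenchel_conj_sandwich[OF V y expansion W(1,2) l \<epsilon>(1,2)])
      (metis real_of_ereal.simps(1))
  have at_s: "?C s = y \<bullet> s - ?r y"
    using d(2)[of 0] d(1) by (simp add: linear_0[OF W(1)])
  have "\<bar>?C t - ?C s - y \<bullet> (t - s) - ((t - s) \<bullet> R (t - s)) / 2\<bar> \<le> e * (norm (t - s))\<^sup>2"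
    if t: "dist t s < min d (d / K)" for t
  proof -
    define h where "h = t - s"
    have h: "norm h \<le> d" "K * norm h \<le> d"
      using t K(1) by (auto simp: h_def dist_norm field_simps)
    have "\<bar>?C (s + h) - (y \<bullet> (s + h) - ?r y + (R h \<bullet> h) / 2)\<bar> \<le> 2 * \<epsilon> * (norm (R h))\<^sup>2"
      using d(2)[of "R h"] h K(2)[of h] by (simp add: R(2))
    also have "\<dots> \<le> 2 * \<epsilon> * (K * norm h)\<^sup>2"
      using K(2)[of h] \<epsilon>(1) by (intro mult_left_mono power_mono) auto
    also have "\<dots> \<le> e * (norm h)\<^sup>2"
      using mult_right_mono[OF \<epsilon>(3), of "(norm h)\<^sup>2"] by (simp add: power_mult_distrib mult_ac)
    finally show ?thesis
      by (simp add: at_s h_def inner_diff_right inner_commute[of "R _"] algebra_simps)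
  qed
  then show "\<forall>\<^sub>F t in nhds s.
      \<bar>?C t - ?C s - y \<bullet> (t - s) - ((t - s) \<bullet> R (t - s)) / 2\<bar> \<le> e * (norm (t - s))\<^sup>2"
    unfolding eventually_nhds_metric using d(1) K(1) by (intro exI[of _ "min d (d / K)"]) auto
qed

lemma
  assumes "V \<in> Gamma_sc2"
  shows Gamma_sc2_proper: "proper V" and Gamma_sc2_econvex: "econvex V"
  using assms by (auto simp: Gamma_sc2_def Gamma_sc_def Gamma_def)

lemma
  assumes "V \<in> Gamma_sc2" "y \<in> interior (edom V)"
  defines "V_real \<equiv> \<lambda>z. real_of_ereal (V z)"
  shows Gamma_sc2_GDERIV: "GDERIV V_real y :> gradient V_real y"
    and Gamma_sc2_has_derivative_gradient:
      "(gradient V_real has_derivative (*v) (hessian V_real y)) (at y)"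
    and Gamma_sc2_pos_definite_hessian: "pos_definite (hessian V_real y)"
proof -
  show "GDERIV V_real y :> gradient V_real y" "pos_definite (hessian V_real y)"
    using assms
    by (auto simp: Gamma_sc2_def Gamma_sc_def essentially_smooth_def intro: GDERIV_gradient)
  have "gradient V_real differentiable (at y)"
    using assms by (auto simp: Gamma_sc2_def)
  then show "(gradient V_real has_derivative (*v) (hessian V_real y)) (at y)"
    unfolding hessian_def jacobian_works .
qed

section \<open>Matrices\<close>

(* As a simp rule it rewrites transpose M *v u to u v* M, which hides nested products of *v. *)
declare transpose_matrix_vector [simp del]

lemma inner_matrix_vector_transpose: "(M *v u) \<bullet> v = u \<bullet> (transpose M *v v)"
  for M :: "real^'m^'n"
  using adjoint_works[OF matrix_vector_mul_linear, of u M v] by (simp add: adjoint_matrix)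

lemma adjoint_symmetric_matrix:
  fixes Q :: "real^'n^'n"
  assumes "transpose Q = Q"
  shows "adjoint ((*v) Q) = (*v) Q"
  using assms adjoint_matrix[of Q] by simp

lemma transpose_diff: "transpose (M - N) = transpose M - transpose N"
  for M N :: "'a::ab_group_add^'m^'n"
  by (simp add: transpose_def vec_eq_iff)

lemma minus_matrix_vector_mult: "(- M) *v u = - (M *v u)" for M :: "'a::ring_1^'m^'n"
  using matrix_vector_mult_diff_rdistrib[of 0 M u] by simp

lemma matrix_vector_mult_minus: "M *v (- u) = - (M *v u)" for M :: "'a::ring_1^'m^'n"
  using matrix_vector_mult_diff_distrib[of M 0 u] by simp

lemma norm_matrix_vector_mult_le: "norm (M *v u) \<le> norm M * norm u" for M :: "real^'m^'n"
proof -
  have "norm (M *v u) = L2_set (\<lambda>i. norm (M $ i \<bullet> u)) UNIV"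
    by (simp add: norm_vec_def matrix_vector_mul_component)
  also have "\<dots> \<le> L2_set (\<lambda>i. norm (M $ i) * norm u) UNIV"
    by (intro L2_set_mono) (auto intro: Cauchy_Schwarz_ineq2)
  also have "\<dots> = norm M * norm u"
    by (simp add: norm_vec_def[of M] L2_set_left_distrib)
  finally show ?thesis .
qed

lemma invertible_iff_ker:
  fixes M :: "'a::field^'n^'n"
  shows "invertible M \<longleftrightarrow> (\<forall>u. M *v u = 0 \<longrightarrow> u = 0)"
  by (simp add: invertible_left_inverse matrix_left_invertible_ker)

lemma definite_imp_invertible:
  fixes M :: "real^'n^'n"
  assumes "\<And>u. u \<noteq> 0 \<Longrightarrow> u \<bullet> (M *v u) \<noteq> 0"
  shows "invertible M"
  unfolding invertible_iff_ker using assms by fastforce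

lemma invertible_Gram_imp_invertible:
  fixes M :: "'a::field^'n^'n"
  assumes "invertible (transpose M ** M)"
  shows "invertible M"
  using assms by (simp add: invertible_det_nz det_mul)

lemma
  fixes M :: "'a::semiring_1^'n^'m"
  assumes "invertible M"
  shows matrix_inv_right: "M ** matrix_inv M = mat 1"
    and matrix_inv_left: "matrix_inv M ** M = mat 1"
  using someI_ex[OF assms[unfolded invertible_def]] by (simp_all add: matrix_inv_def)

lemma matrix_inv_unique:
  fixes M N :: "'a::field^'n^'n"
  assumes "M ** N = mat 1"
  shows "matrix_inv M = N"
proof -
  have "invertible M"
    using assms by (auto simp: invertible_right_inverse)
  then have "matrix_inv M = matrix_inv M ** (M ** N)" "matrix_inv M ** M = mat 1"
    using assms by (simp_all add: matrix_inv_left)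
  then show ?thesis
    by (simp add: matrix_mul_assoc)
qed

lemma tendsto_det:
  fixes M :: "'b \<Rightarrow> 'a::{comm_ring_1,real_normed_algebra}^'n^'n"
  assumes "(M \<longlongrightarrow> N) F"
  shows "((\<lambda>x. det (M x)) \<longlongrightarrow> det N) F"
  unfolding det_def using assms by (intro tendsto_intros)

lemma eventually_invertible:
  fixes M :: "'b \<Rightarrow> 'a::real_normed_field^'n^'n"
  assumes "(M \<longlongrightarrow> N) F" "invertible N"
  shows "\<forall>\<^sub>F x in F. invertible (M x)"
  using tendsto_imp_eventually_ne[OF tendsto_det[OF assms(1)]] assms(2)
  by (simp add: invertible_det_nz)

lemma tendsto_matrix_inv:
  fixes M :: "'b \<Rightarrow> real^'n^'n"
  assumes M: "(M \<longlongrightarrow> N) F" and N: "invertible N"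
  shows "((\<lambda>x. matrix_inv (M x)) \<longlongrightarrow> matrix_inv N) F"
proof -
  let ?replace = "\<lambda>P i k. (\<chi> a c. if c = k then axis i 1 $ a else P $ a $ c) :: real^'n^'n"
  have cramer_inv: "matrix_inv P $ k $ i = det (?replace P i k) / det P"
    if "det P \<noteq> 0" for P :: "real^'n^'n" and i k
  proof -
    have "P *v (matrix_inv P *v axis i 1) = axis i 1"
      using that by (simp add: matrix_vector_mul_assoc matrix_inv_right invertible_det_nz)
    then have "matrix_inv P *v axis i 1 = (\<chi> k. det (?replace P i k) / det P)"
      using cramer[OF that] by blast
    then show ?thesis
      by (simp add: matrix_vector_mult_basis column_def vec_eq_iff)
  qed
  have det: "((\<lambda>x. det (M x)) \<longlongrightarrow> det N) F" "det N \<noteq> 0"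
    using M N by (simp_all add: tendsto_det invertible_det_nz)
  have "((\<lambda>x. matrix_inv (M x) $ k $ i) \<longlongrightarrow> matrix_inv N $ k $ i) F" for i k
  proof (rule Lim_transform_eventually)
    have "((\<lambda>x. ?replace (M x) i k $ a $ c) \<longlongrightarrow> ?replace N i k $ a $ c) F" for a c
      using M by (auto intro!: tendsto_intros)
    then have "((\<lambda>x. det (?replace (M x) i k)) \<longlongrightarrow> det (?replace N i k)) F"
      by (intro tendsto_det vec_tendstoI)
    then show "((\<lambda>x. det (?replace (M x) i k) / det (M x)) \<longlongrightarrow> matrix_inv N $ k $ i) F"
      using det by (simp add: cramer_inv tendsto_divide)
    show "\<forall>\<^sub>F x in F. det (?replace (M x) i k) / det (M x) = matrix_inv (M x) $ k $ i"
      using tendsto_imp_eventually_ne[OF det] by eventually_elim (simp add: cramer_inv)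
  qed
  then show ?thesis
    by (intro vec_tendstoI)
qed

lemma vanishing_matrix_form_smallo:
  fixes G :: "real^'m^'n" and M :: "real^'m \<Rightarrow> real^'n^'n"
  assumes "(M \<longlongrightarrow> 0) (nhds x)"
  shows "(\<lambda>y. (G *v (y - x)) \<bullet> (M y *v (G *v (y - x)))) \<in> o[nhds x](\<lambda>y. (norm (y - x))\<^sup>2)"
proof (rule landau_o.smallI)
  fix e :: real assume "e > 0"
  define c where "c = (norm G)\<^sup>2 + 1"
  have c: "c > 0"
    by (simp add: c_def add_nonneg_pos)
  have "\<forall>\<^sub>F y in nhds x. norm (M y) < e / c"
    using tendstoD[OF assms, of "e / c"] \<open>e > 0\<close> c by simp
  then show "\<forall>\<^sub>F y in nhds x.
      norm ((G *v (y - x)) \<bullet> (M y *v (G *v (y - x)))) \<le> e * norm ((norm (y - x))\<^sup>2)"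
  proof eventually_elim
    case (elim y)
    let ?g = "G *v (y - x)"
    have "(norm ?g)\<^sup>2 \<le> (norm G * norm (y - x))\<^sup>2"
      by (intro power_mono norm_matrix_vector_mult_le norm_ge_zero)
    also have "\<dots> \<le> c * (norm (y - x))\<^sup>2"
      unfolding power_mult_distrib by (intro mult_right_mono) (simp_all add: c_def)
    finally have g: "(norm ?g)\<^sup>2 \<le> c * (norm (y - x))\<^sup>2" .
    have "\<bar>?g \<bullet> (M y *v ?g)\<bar> \<le> norm ?g * (norm (M y) * norm ?g)"
      by (intro order_trans[OF Cauchy_Schwarz_ineq2] mult_left_mono norm_matrix_vector_mult_le) simp
    also have "\<dots> = norm (M y) * (norm ?g)\<^sup>2"
      by (simp add: power2_eq_square)
    also have "\<dots> \<le> e / c * (c * (norm (y - x))\<^sup>2)"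
      using elim g \<open>e > 0\<close> c by (intro mult_mono) auto
    finally show ?case
      using c by simp
  qed
qed

lemma invertible_mult_minus_id_commute:
  fixes A :: "'a::field^'m^'n" and B :: "'a^'n^'m"
  assumes "invertible (A ** B - mat 1)"
  shows "invertible (B ** A - mat 1)"
  unfolding invertible_iff_ker
proof (intro allI impI)
  fix w assume "(B ** A - mat 1) *v w = 0"
  then have w: "B *v (A *v w) = w"
    by (simp add: matrix_vector_mult_diff_rdistrib matrix_vector_mul_assoc)
  then have "(A ** B - mat 1) *v (A *v w) = 0"
    by (simp add: matrix_vector_mult_diff_rdistrib flip: matrix_vector_mul_assoc)
  then have "A *v w = 0"
    using assms by (simp add: invertible_iff_ker)
  then show "w = 0"
    using w by simp
qed

lemma congruent_form_iff:
  fixes S Q :: "real^'n^'n"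
  assumes "invertible S"
  shows "(\<forall>u. u \<noteq> 0 \<longrightarrow> P (u \<bullet> ((transpose S ** Q ** S) *v u))) \<longleftrightarrow>
         (\<forall>w. w \<noteq> 0 \<longrightarrow> P (w \<bullet> (Q *v w)))"
proof -
  have form: "u \<bullet> ((transpose S ** Q ** S) *v u) = (S *v u) \<bullet> (Q *v (S *v u))" for u
    by (simp add: inner_matrix_vector_transpose matrix_vector_mul_assoc matrix_mul_assoc)
  have nonzero: "S *v u \<noteq> 0 \<longleftrightarrow> u \<noteq> 0" for u
    using assms by (auto simp: invertible_iff_ker)
  have "w = S *v (matrix_inv S *v w)" for w
    using assms by (simp add: matrix_vector_mul_assoc matrix_inv_right)
  then show ?thesis
    unfolding form by (metis nonzero)
qed

lemma inner_Gram_minus_id: "w \<bullet> ((transpose N ** N - mat 1) *v w) = (norm (N *v w))\<^sup>2 - (norm w)\<^sup>2"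
  for N :: "real^'m^'n"
  by (simp add: matrix_vector_mult_diff_rdistrib inner_diff_right power2_norm_eq_inner
      inner_matrix_vector_transpose flip: matrix_vector_mul_assoc)

theorem
  fixes f :: "real^'m \<Rightarrow> real" and S :: "real^'m^'m" and N :: "real^'m^'n"
  defines "Q \<equiv> transpose S ** (transpose N ** N - mat 1) ** S"
  assumes f: "has_quadratic_expansion f x 0 ((*v) Q)" and x: "x \<in> interior D"
    and S: "invertible S" and N: "invertible (transpose N ** N - mat 1)"
  shows local_maximizer_on_iff_Gram:
      "local_maximizer_on D f x \<longleftrightarrow> (\<forall>w. w \<noteq> 0 \<longrightarrow> norm (N *v w) < norm w)"
    and local_minimizer_on_iff_Gram:
      "local_minimizer_on D f x \<longleftrightarrow> (\<forall>w. w \<noteq> 0 \<longrightarrow> norm (N *v w) > norm w)"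
proof -
  have sym: "adjoint ((*v) Q) = (*v) Q"
    by (intro adjoint_symmetric_matrix)
      (simp add: Q_def matrix_transpose_mul transpose_diff matrix_mul_assoc)
  have inj: "inj ((*v) Q)"
    unfolding Q_def using S N by (intro inj_matrix_vector_mult invertible_mult transpose_invertible)
  have form: "(\<forall>u. u \<noteq> 0 \<longrightarrow> P (u \<bullet> (Q *v u))) \<longleftrightarrow>
      (\<forall>w. w \<noteq> 0 \<longrightarrow> P ((norm (N *v w))\<^sup>2 - (norm w)\<^sup>2))" for P
    unfolding Q_def congruent_form_iff[OF S] inner_Gram_minus_id ..
  have power2_less_iff: "(norm a)\<^sup>2 < (norm b)\<^sup>2 \<longleftrightarrow> norm a < norm b"
    for a :: "real^'k" and b :: "real^'l"
    by (simp flip: not_le)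
  show "local_maximizer_on D f x \<longleftrightarrow> (\<forall>w. w \<noteq> 0 \<longrightarrow> norm (N *v w) < norm w)"
    using local_maximizer_on_iff_negative_form[OF f x matrix_vector_mul_linear sym inj]
      form[of "\<lambda>r. r < 0"]
    by (simp add: power2_less_iff)
  show "local_minimizer_on D f x \<longleftrightarrow> (\<forall>w. w \<noteq> 0 \<longrightarrow> norm (N *v w) > norm w)"
    using local_minimizer_on_iff_positive_form[OF f x matrix_vector_mul_linear sym inj]
      form[of "\<lambda>r. r > 0"]
    by (simp add: power2_less_iff)
qed

lemma matrix_inv_minus:
  fixes M :: "'a::field^'n^'n"
  assumes "invertible M"
  shows "matrix_inv (- M) = - matrix_inv M"
proof (rule matrix_inv_unique)
  show "- M ** - matrix_inv M = mat 1"
    using matrix_inv_right[OF assms]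
    by (simp add: matrix_eq minus_matrix_vector_mult matrix_vector_mult_minus
        flip: matrix_vector_mul_assoc)
qed

lemma transpose_matrix_inv_left:
  fixes M :: "'a::field^'n^'n"
  assumes "invertible M"
  shows "transpose M ** transpose (matrix_inv M) = mat 1"
  using assms by (simp add: matrix_inv_left flip: matrix_transpose_mul)

lemma matrix_inv_Gram:
  fixes M :: "'a::field^'n^'n"
  assumes "invertible M"
  shows "matrix_inv (transpose M ** M) = matrix_inv M ** transpose (matrix_inv M)"
proof (rule matrix_inv_unique)
  have "transpose M ** M ** (matrix_inv M ** transpose (matrix_inv M))
      = transpose M ** (M ** matrix_inv M) ** transpose (matrix_inv M)"
    by (simp only: matrix_mul_assoc)
  then show "transpose M ** M ** (matrix_inv M ** transpose (matrix_inv M)) = mat 1"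
    using assms by (simp add: matrix_inv_right transpose_matrix_inv_left)
qed

lemma
  fixes E :: "real^'n^'n" and F :: "real^'m^'m" and J :: "real^'n^'m"
  assumes E: "invertible E" and F: "invertible F"
  defines "M \<equiv> transpose (matrix_inv E) ** transpose J ** transpose F"
  shows Gram_factorization_primal:
      "transpose J ** (transpose F ** F) ** J - transpose E ** E
        = transpose E ** (M ** transpose M - mat 1) ** E"
    and Gram_factorization_dual:
      "J ** matrix_inv (transpose E ** E) ** transpose J - matrix_inv (transpose F ** F)
        = matrix_inv F ** (transpose M ** M - mat 1) ** transpose (matrix_inv F)"
proof -
  have cancel: "N *v (matrix_inv N *v u) = u" "matrix_inv N *v (N *v u) = u"
      "transpose N *v (transpose (matrix_inv N) *v u) = u"
    if "invertible N" for N :: "real^'k^'k" and u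
    using that
    by (simp_all add: matrix_vector_mul_assoc matrix_inv_right matrix_inv_left
        transpose_matrix_inv_left)
  show "transpose J ** (transpose F ** F) ** J - transpose E ** E
      = transpose E ** (M ** transpose M - mat 1) ** E"
    by (simp add: matrix_eq M_def matrix_transpose_mul matrix_vector_mult_diff_rdistrib
        matrix_vector_mult_diff_distrib cancel[OF E] flip: matrix_vector_mul_assoc)
  show "J ** matrix_inv (transpose E ** E) ** transpose J - matrix_inv (transpose F ** F)
      = matrix_inv F ** (transpose M ** M - mat 1) ** transpose (matrix_inv F)"
    by (simp add: matrix_eq M_def matrix_inv_Gram E F matrix_transpose_mul
        matrix_vector_mult_diff_rdistrib matrix_vector_mult_diff_distrib cancel[OF F]
        flip: matrix_vector_mul_assoc)
qed

lemma norm_adjoint_less: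
  fixes N :: "'a::euclidean_space \<Rightarrow> 'b::euclidean_space"
  assumes "linear N" and less: "\<And>v. v \<noteq> 0 \<Longrightarrow> norm (N v) < norm v" and "w \<noteq> 0"
  shows "norm (adjoint N w) < norm w"
proof (cases "adjoint N w = 0")
  case False
  let ?p = "adjoint N w"
  have "norm ?p * norm ?p = N ?p \<bullet> w"
    using adjoint_works[OF \<open>linear N\<close>, of ?p w]
    by (simp flip: power2_eq_square power2_norm_eq_inner)
  also have "\<dots> \<le> norm (N ?p) * norm w"
    by (rule norm_cauchy_schwarz)
  also have "\<dots> < norm ?p * norm w"
    using less[OF False] \<open>w \<noteq> 0\<close> by simp
  finally show ?thesis
    using False by simp
qed (use assms in simp)

lemma norm_adjoint_greater:
  fixes N :: "'a::euclidean_space \<Rightarrow> 'b::euclidean_space"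
  assumes "linear N" and dim: "DIM('a) = DIM('b)"
    and greater: "\<And>v. v \<noteq> 0 \<Longrightarrow> norm (N v) > norm v" and "w \<noteq> 0"
  shows "norm (adjoint N w) > norm w"
proof -
  have "inj N"
    unfolding linear_injective_0[OF \<open>linear N\<close>] using greater by fastforce
  then have "surj N"
    using \<open>linear N\<close> dim by (intro linear_injective_imp_surjective) simp_all
  then obtain v where w: "w = N v"
    by (rule surjE)
  then have v: "norm v < norm w"
    using greater \<open>w \<noteq> 0\<close> linear_0[OF \<open>linear N\<close>] by metis
  have "norm w * norm w = v \<bullet> adjoint N w"
    by (simp add: adjoint_works[OF \<open>linear N\<close>] w flip: power2_eq_square power2_norm_eq_inner)
  also have "\<dots> \<le> norm v * norm (adjoint N w)"
    by (rule norm_cauchy_schwarz)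
  finally have le: "norm w * norm w \<le> norm v * norm (adjoint N w)" .
  show ?thesis
  proof (rule ccontr)
    assume "\<not> ?thesis"
    then have "norm v * norm (adjoint N w) \<le> norm v * norm w"
      by (intro mult_left_mono) auto
    also have "\<dots> < norm w * norm w"
      using v \<open>w \<noteq> 0\<close> by simp
    finally show False
      using le by simp
  qed
qed

lemma norm_transpose_less_iff:
  fixes N :: "real^'m^'n"
  shows "(\<forall>w. w \<noteq> 0 \<longrightarrow> norm (transpose N *v w) < norm w) \<longleftrightarrow> (\<forall>v. v \<noteq> 0 \<longrightarrow> norm (N *v v) < norm v)"
  using norm_adjoint_less[OF matrix_vector_mul_linear, of N]
    norm_adjoint_less[OF matrix_vector_mul_linear, of "transpose N"]
  by (auto simp: adjoint_matrix)

lemma norm_transpose_greater_iff: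
  fixes N :: "real^'m^'n"
  assumes "CARD('m) = CARD('n)"
  shows "(\<forall>w. w \<noteq> 0 \<longrightarrow> norm (transpose N *v w) > norm w) \<longleftrightarrow> (\<forall>v. v \<noteq> 0 \<longrightarrow> norm (N *v v) > norm v)"
  using norm_adjoint_greater[OF matrix_vector_mul_linear, of N]
    norm_adjoint_greater[OF matrix_vector_mul_linear, of "transpose N"] assms
  by (auto simp: adjoint_matrix)

lemma linear_norm_sphere_iff:
  fixes N :: "'a::real_normed_vector \<Rightarrow> 'b::real_normed_vector"
  assumes "linear N"
  shows "(\<forall>v\<in>sphere 0 1. P (norm (N v))) \<longleftrightarrow> (\<forall>v. v \<noteq> 0 \<longrightarrow> P (norm (N v) / norm v))"
proof (intro iffI allI impI ballI)
  fix v :: 'a assume P: "\<forall>v\<in>sphere 0 1. P (norm (N v))" and "v \<noteq> 0"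
  have "norm (N (v /\<^sub>R norm v)) = norm (N v) / norm v"
    by (simp add: linear_scale[OF assms] divide_inverse mult.commute)
  moreover have "v /\<^sub>R norm v \<in> sphere 0 1"
    using \<open>v \<noteq> 0\<close> by simp
  ultimately show "P (norm (N v) / norm v)"
    using P by metis
next
  fix v :: 'a assume P: "\<forall>v. v \<noteq> 0 \<longrightarrow> P (norm (N v) / norm v)" and "v \<in> sphere 0 1"
  then show "P (norm (N v))"
    by (metis div_by_1 mem_sphere_0 norm_zero zero_neq_one)
qed

section \<open>Quadratic families\<close>

definition qvec_jacobian ::
    "('m option \<Rightarrow> real^'n^'n) \<Rightarrow> ('m option \<Rightarrow> real^'n) \<Rightarrow> real^'n \<Rightarrow> real^'n^'m" where
  "qvec_jacobian A b x = (\<chi> i. A (Some i) *v x - b (Some i))"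

lemma qvec_jacobian_mult: "qvec_jacobian A b x *v u = (\<chi> i. (A (Some i) *v x - b (Some i)) \<bullet> u)"
  by (simp add: vec_eq_iff matrix_vector_mul_component qvec_jacobian_def)

lemma transpose_qvec_jacobian_mult:
  "transpose (qvec_jacobian A b x) *v s = (\<Sum>i\<in>UNIV. (s $ i) *\<^sub>R (A (Some i) *v x - b (Some i)))"
  by (simp add: vec_eq_iff matrix_vector_mult_def transpose_def qvec_jacobian_def mult.commute)

lemma linear_lincomb:
  assumes "linear \<phi>"
  shows "\<phi> (lincomb a \<sigma>) = lincomb (\<lambda>k. \<phi> (a k)) \<sigma>"
  by (simp add: lincomb_def linear_sum[OF assms] linear_scale[OF assms])

lemma lincomb_mult: "lincomb A \<sigma> *v u = lincomb (\<lambda>k. A k *v u) \<sigma>"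
  for A :: "'m::finite option \<Rightarrow> real^'n^'k"
  by (intro linear_lincomb[of "\<lambda>M. M *v u"] linearI)
    (simp_all add: matrix_vector_mult_add_rdistrib scaleR_matrix_vector_assoc)

lemma lincomb_mult_diff_lincomb:
  "lincomb A \<sigma> *v x - lincomb b \<sigma> = A None *v x - b None + transpose (qvec_jacobian A b x) *v \<sigma>"
  unfolding lincomb_mult
  by (simp add: lincomb_eq transpose_qvec_jacobian_mult scaleR_diff_right sum_subtractf)

lemma quad_lincomb:
  "quad (lincomb A \<sigma>) (lincomb b \<sigma>) (lincomb c \<sigma>) x
     = quad (A None) (b None) (c None) x + qvec A b c x \<bullet> \<sigma>"
proof -
  have "x \<bullet> lincomb (\<lambda>k. A k *v x) \<sigma> = lincomb (\<lambda>k. x \<bullet> (A k *v x)) \<sigma>"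
    "lincomb b \<sigma> \<bullet> x = lincomb (\<lambda>k. b k \<bullet> x) \<sigma>"
    by (auto intro!: linear_lincomb[where \<phi> = "\<lambda>v. v \<bullet> x"] linear_lincomb bounded_linear.linear
        bounded_linear_inner_right bounded_linear_inner_left)
  then have "quad (lincomb A \<sigma>) (lincomb b \<sigma>) (lincomb c \<sigma>) x
      = 1/2 * lincomb (\<lambda>k. x \<bullet> (A k *v x)) \<sigma> - lincomb (\<lambda>k. b k \<bullet> x) \<sigma> + lincomb c \<sigma>"
    by (simp add: quad_def lincomb_mult)
  also have "\<dots> = lincomb (\<lambda>k. quad (A k) (b k) (c k) x) \<sigma>"
    by (simp add: lincomb_def quad_def algebra_simps sum.distrib sum_subtractf sum_distrib_left)
  finally show ?thesis
    by (simp add: lincomb_eq qvec_def inner_vec_def mult.commute)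
qed

lemma tendsto_lincomb: "(lincomb A \<longlongrightarrow> lincomb A \<sigma>) (nhds \<sigma>)"
  for A :: "'m::finite option \<Rightarrow> 'a::real_normed_vector"
  unfolding lincomb_eq[abs_def] by (intro tendsto_intros filterlim_ident)

lemma mem_interior_S_col:
  assumes \<sigma>: "\<sigma> \<in> interior (edom (fenchel_conj V))" and "invertible (lincomb A \<sigma>)"
  shows "\<sigma> \<in> interior (S_col V A b)"
  unfolding mem_interior_iff_eventually_nhds
  using eventually_invertible[OF tendsto_lincomb assms(2)] \<sigma>[unfolded mem_interior_iff_eventually_nhds]
proof eventually_elim
  case (elim \<tau>)
  then have "lincomb A \<tau> *v (matrix_inv (lincomb A \<tau>) *v lincomb b \<tau>) = lincomb b \<tau>"
    by (simp add: matrix_vector_mul_assoc matrix_inv_right)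
  then show ?case
    using elim unfolding S_col_def by (metis (mono_tags, lifting) mem_Collect_eq rangeI)
qed

lemma Xi_eq_quad:
  assumes "fenchel_conj V \<tau> = ereal w"
  shows "Xi V A b c y \<tau> = ereal (quad (lincomb A \<tau>) (lincomb b \<tau>) (lincomb c \<tau> - w) y)"
  by (simp add: Xi_eq assms quad_def)

lemma GDERIV_quad:
  assumes "transpose M = M"
  shows "GDERIV (quad M v r) y :> M *v y - v"
proof -
  have "((\<lambda>y. 1/2 * (y \<bullet> (M *v y)) - v \<bullet> y + r) has_derivative
      (\<lambda>h. 1/2 * (y \<bullet> (M *v h) + h \<bullet> (M *v y)) - v \<bullet> h)) (at y)"
    by (auto intro!: derivative_eq_intros bounded_linear_imp_has_derivative)
  moreover have "y \<bullet> (M *v h) = h \<bullet> (M *v y)" for h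
    using inner_matrix_vector_transpose[of M h y] assms by (simp add: inner_commute)
  ultimately show ?thesis
    by (simp add: gderiv_def quad_def[abs_def] inner_diff_right inner_commute[of v])
qed

lemma quad_eq_critical_value:
  assumes "transpose M = M" "M *v y = v"
  shows "quad M v r x = quad M v r y + 1/2 * ((x - y) \<bullet> (M *v (x - y)))"
proof -
  have "y \<bullet> (M *v x) = v \<bullet> x"
    using inner_matrix_vector_transpose[of M y x] assms by simp
  then show ?thesis
    using assms(2)
    by (simp add: quad_def matrix_vector_mult_diff_distrib inner_diff_left inner_diff_right
        inner_commute[of _ v] field_simps)
qed

lemma has_derivative_vec_lambda:
  fixes f :: "'a::real_normed_vector \<Rightarrow> 'm::finite \<Rightarrow> real"
  assumes "\<And>i. ((\<lambda>y. f y i) has_derivative (\<lambda>h. f' h i)) F"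
  shows "((\<lambda>y. \<chi> i. f y i) has_derivative (\<lambda>h. \<chi> i. f' h i)) F"
proof -
  have axis_sum: "(\<chi> i. z i) = (\<Sum>i\<in>UNIV. z i *\<^sub>R axis i 1)" for z :: "'m \<Rightarrow> real"
    by (simp add: vec_eq_iff axis_def if_distrib cong: if_cong)
  show ?thesis
    unfolding axis_sum using assms by (intro has_derivative_sum has_derivative_scaleR_left)
qed

locale quadratic_family =
  fixes A :: "'m::finite option \<Rightarrow> real^'n^'n"
    and b :: "'m option \<Rightarrow> real^'n"
    and c :: "'m option \<Rightarrow> real"
  assumes symmetric: "transpose (A k) = A k"
begin

lemma transpose_lincomb_A: "transpose (lincomb A \<sigma>) = lincomb A \<sigma>"
  by (rule transpose_lincomb) (rule symmetric)

lemma has_derivative_qvec: "(qvec A b c has_derivative (*v) (qvec_jacobian A b y)) (at y)"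
  unfolding qvec_def qvec_jacobian_mult
  using GDERIV_quad[OF symmetric]
  by (intro has_derivative_vec_lambda) (simp add: gderiv_def inner_commute)

lemma open_X0: "open (X0 V A b c)"
proof -
  have "continuous_on UNIV (qvec A b c)"
    by (rule has_derivative_continuous_on)
      (rule has_derivative_at_withinI, rule has_derivative_qvec)
  then show ?thesis
    using open_vimage[OF open_interior] by (simp add: X0_def vimage_def)
qed

lemma primal_eq_on_X0:
  assumes "proper V" "y \<in> X0 V A b c"
  shows "primal V A b c y
    = ereal (quad (A None) (b None) (c None) y + real_of_ereal (V (qvec A b c y)))"
proof -
  have "qvec A b c y \<in> edom V"
    using assms(2) interior_subset by (auto simp: X0_def)
  then show ?thesis
    unfolding primal_def by (subst proper_eq_ereal[OF assms(1)]) simp_all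
qed

lemma GDERIV_primal:
  assumes V: "proper V" and y: "y \<in> X0 V A b c"
    and g: "GDERIV (\<lambda>z. real_of_ereal (V z)) (qvec A b c y) :> g"
  shows "GDERIV (\<lambda>z. real_of_ereal (primal V A b c z)) y :> lincomb A g *v y - lincomb b g"
proof -
  let ?f = "\<lambda>z. quad (A None) (b None) (c None) z + real_of_ereal (V (qvec A b c z))"
  have "(?f has_derivative
      (\<lambda>h. h \<bullet> (A None *v y - b None) + (qvec_jacobian A b y *v h) \<bullet> g)) (at y)"
    by (intro has_derivative_add has_derivative_compose[OF has_derivative_qvec]
        GDERIV_quad[OF symmetric, unfolded gderiv_def] g[unfolded gderiv_def])
  then have "(?f has_derivative (\<lambda>h. h \<bullet> (lincomb A g *v y - lincomb b g))) (at y)"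
    by (simp add: lincomb_mult_diff_lincomb inner_add_right inner_matrix_vector_transpose)
  then show ?thesis
    unfolding gderiv_def
    by (rule has_derivative_transform_within_open[OF _ open_X0 y]) (simp add: primal_eq_on_X0[OF V])
qed

lemma has_derivative_gradient_primal:
  assumes g: "(g has_derivative (*v) W) (at (qvec A b c x))"
  defines "J \<equiv> qvec_jacobian A b x"
  shows "((\<lambda>y. lincomb A (g (qvec A b c y)) *v y - lincomb b (g (qvec A b c y))) has_derivative
     (*v) (lincomb A (g (qvec A b c x)) + transpose J ** W ** J)) (at x)"
proof -
  have "((\<lambda>y. g (qvec A b c y)) has_derivative (\<lambda>u. W *v (J *v u))) (at x)"
    using has_derivative_qvec g unfolding J_def by (rule has_derivative_compose)
  then have component:
    "((\<lambda>y. g (qvec A b c y) $ i) has_derivative (\<lambda>u. (W *v (J *v u)) $ i)) (at x)" for i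
    by (rule bounded_linear.has_derivative[OF bounded_linear_vec_nth])
  have affine: "((\<lambda>y. M *v y - v) has_derivative (*v) M) (at x)" for M :: "real^'n^'n" and v
    by (auto intro!: derivative_eq_intros bounded_linear_imp_has_derivative)
  have "((\<lambda>y. A None *v y - b None +
      (\<Sum>i\<in>UNIV. (g (qvec A b c y) $ i) *\<^sub>R (A (Some i) *v y - b (Some i)))) has_derivative
    (\<lambda>u. A None *v u + (\<Sum>i\<in>UNIV. (g (qvec A b c x) $ i) *\<^sub>R (A (Some i) *v u) +
       ((W *v (J *v u)) $ i) *\<^sub>R (A (Some i) *v x - b (Some i))))) (at x)"
    by (intro has_derivative_add has_derivative_sum has_derivative_scaleR affine component)
  moreover have "(*v) (lincomb A (g (qvec A b c x)) + transpose J ** W ** J) =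
      (\<lambda>u. A None *v u + (\<Sum>i\<in>UNIV. (g (qvec A b c x) $ i) *\<^sub>R (A (Some i) *v u) +
        ((W *v (J *v u)) $ i) *\<^sub>R (A (Some i) *v x - b (Some i))))"
    by (simp add: fun_eq_iff matrix_vector_mult_add_rdistrib lincomb_mult
        flip: matrix_vector_mul_assoc)
      (simp add: lincomb_eq sum.distrib J_def transpose_qvec_jacobian_mult)
  ultimately show ?thesis
    by (simp add: lincomb_mult_diff_lincomb transpose_qvec_jacobian_mult)
qed

lemma dual_eq_Schur_complement:
  fixes x :: "real^'n"
  assumes w: "fenchel_conj V \<tau> = ereal w" and "invertible (lincomb A \<tau>)"
  defines "\<rho> \<equiv> lincomb A \<tau> *v x - lincomb b \<tau>"
  shows "dual V A b c \<tau> = quad (A None) (b None) (c None) x + qvec A b c x \<bullet> \<tau>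
      - (\<rho> \<bullet> (matrix_inv (lincomb A \<tau>) *v \<rho>)) / 2 - w"
proof -
  let ?A = "lincomb A \<tau>" and ?q = "quad (lincomb A \<tau>) (lincomb b \<tau>) (lincomb c \<tau>)"
  define u where "u = matrix_inv ?A *v \<rho>"
  have u: "?A *v u = \<rho>"
    using assms(2) by (simp add: u_def matrix_vector_mul_assoc matrix_inv_right)
  then have critical: "?A *v (x - u) = lincomb b \<tau>"
    by (simp add: \<rho>_def matrix_vector_mult_diff_distrib)
  have "dual V A b c \<tau> = ?q (x - u) - w"
    using dual_eq[OF symmetric critical] by (simp add: Xi_eq_quad[OF w]) (simp add: quad_def)
  also have "?q (x - u) = ?q x - (u \<bullet> \<rho>) / 2"
    using quad_eq_critical_value[OF transpose_lincomb_A critical, of "lincomb c \<tau>" x] u by simp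
  finally show ?thesis
    by (simp add: quad_lincomb u_def inner_commute)
qed

lemma critical_point_Xi_stationary:
  assumes V: "proper V" and crit: "critical_point_Xi V A b c x \<sigma>"
  shows "lincomb A \<sigma> *v x = lincomb b \<sigma>"
proof -
  have \<sigma>: "\<sigma> \<in> edom (fenchel_conj V)"
    and der: "GDERIV (\<lambda>(y, \<tau>). real_of_ereal (Xi V A b c y \<tau>)) (x, \<sigma>) :> 0"
    using crit interior_subset by (auto simp: critical_point_Xi_def)
  obtain w where w: "fenchel_conj V \<sigma> = ereal w"
    using proper_eq_ereal[OF proper_fenchel_conj[OF V \<sigma>] \<sigma>] ..
  have "GDERIV (quad (lincomb A \<sigma>) (lincomb b \<sigma>) (lincomb c \<sigma> - w)) x :> 0"
    using GDERIV_partial(1)[OF der] by (simp add: Xi_eq_quad[OF w])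
  moreover have "GDERIV (quad (lincomb A \<sigma>) (lincomb b \<sigma>) (lincomb c \<sigma> - w)) x
      :> lincomb A \<sigma> *v x - lincomb b \<sigma>"
    by (rule GDERIV_quad) (rule transpose_lincomb_A)
  ultimately have "lincomb A \<sigma> *v x - lincomb b \<sigma> = 0"
    by (metis gradient_eqI)
  then show ?thesis by simp
qed

lemma critical_point_Xi_GDERIV_conj:
  assumes V: "proper V" and crit: "critical_point_Xi V A b c x \<sigma>"
  shows "GDERIV (\<lambda>\<tau>. real_of_ereal (fenchel_conj V \<tau>)) \<sigma> :> qvec A b c x"
proof -
  let ?q = "\<lambda>\<tau>. quad (A None) (b None) (c None) x + qvec A b c x \<bullet> \<tau>"
  have \<sigma>: "\<sigma> \<in> interior (edom (fenchel_conj V))"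
    and der: "GDERIV (\<lambda>(y, \<tau>). real_of_ereal (Xi V A b c y \<tau>)) (x, \<sigma>) :> 0"
    using crit by (simp_all add: critical_point_Xi_def)
  have "((\<lambda>\<tau>. ?q \<tau> - real_of_ereal (Xi V A b c x \<tau>)) has_derivative (\<lambda>h. h \<bullet> qvec A b c x)) (at \<sigma>)"
    using GDERIV_partial(2)[OF der]
    by (auto intro!: derivative_eq_intros simp: gderiv_def inner_commute)
  then show ?thesis
    unfolding gderiv_def
  proof (rule has_derivative_transform_within_open[OF _ open_interior \<sigma>])
    fix \<tau> assume "\<tau> \<in> interior (edom (fenchel_conj V))"
    then have \<tau>: "\<tau> \<in> edom (fenchel_conj V)"
      using interior_subset by blast
    obtain w where "fenchel_conj V \<tau> = ereal w"
      using proper_eq_ereal[OF proper_fenchel_conj[OF V \<tau>] \<tau>] ..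
    then show "?q \<tau> - real_of_ereal (Xi V A b c x \<tau>) = real_of_ereal (fenchel_conj V \<tau>)"
      by (simp add: Xi_def)
  qed
qed

lemma dual_eq_at_stationary:
  fixes x :: "real^'n"
  assumes x: "lincomb A \<sigma> *v x = lincomb b \<sigma>"
    and w: "fenchel_conj V \<tau> = ereal w" and invertible: "invertible (lincomb A \<tau>)"
  defines "g \<equiv> transpose (qvec_jacobian A b x) *v (\<tau> - \<sigma>)"
  shows "dual V A b c \<tau> = quad (A None) (b None) (c None) x + qvec A b c x \<bullet> \<tau>
      - (g \<bullet> (matrix_inv (lincomb A \<tau>) *v g)) / 2 - w"
proof -
  have "lincomb A \<tau> *v x - lincomb b \<tau> = g"
    using x lincomb_mult_diff_lincomb[of A \<sigma> x b] lincomb_mult_diff_lincomb[of A \<tau> x b]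
    by (simp add: g_def matrix_vector_mult_diff_distrib algebra_simps)
  then show ?thesis
    using dual_eq_Schur_complement[OF w invertible, of x] by simp
qed

theorem has_quadratic_expansion_dual:
  assumes V: "proper V" and \<sigma>: "\<sigma> \<in> interior (edom (fenchel_conj V))"
    and invertible: "invertible (lincomb A \<sigma>)" and x: "lincomb A \<sigma> *v x = lincomb b \<sigma>"
    and conj_expansion: "has_quadratic_expansion (\<lambda>\<tau>. real_of_ereal (fenchel_conj V \<tau>)) \<sigma>
      (qvec A b c x) ((*v) R)"
  defines "J \<equiv> qvec_jacobian A b x"
  shows "has_quadratic_expansion (dual V A b c) \<sigma> 0
     ((*v) (- (J ** matrix_inv (lincomb A \<sigma>) ** transpose J) - R))"
proof -
  let ?C = "\<lambda>\<tau>. real_of_ereal (fenchel_conj V \<tau>)" and ?P = "\<lambda>\<tau>. matrix_inv (lincomb A \<tau>)"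
    and ?g = "\<lambda>\<tau>. transpose J *v (\<tau> - \<sigma>)"
  let ?Q = "- (J ** ?P \<sigma> ** transpose J) - R"
  have \<sigma>_dom: "\<sigma> \<in> edom (fenchel_conj V)"
    using \<sigma> interior_subset by blast
  note dual = dual_eq_at_stationary[OF x proper_eq_ereal[OF proper_fenchel_conj[OF V \<sigma>_dom]],
      folded J_def]
  have form: "h \<bullet> (?Q *v h)
      = - ((transpose J *v h) \<bullet> (?P \<sigma> *v (transpose J *v h))) - h \<bullet> (R *v h)" for h
    by (simp add: matrix_vector_mult_diff_rdistrib minus_matrix_vector_mult inner_diff_right
        inner_matrix_vector_transpose flip: matrix_vector_mul_assoc)
  have "\<forall>\<^sub>F \<tau> in nhds \<sigma>. \<tau> \<in> edom (fenchel_conj V)"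
    using \<sigma> by (simp add: mem_interior_iff_eventually_nhds)
  with eventually_invertible[OF tendsto_lincomb invertible]
  have remainder: "\<forall>\<^sub>F \<tau> in nhds \<sigma>.
      dual V A b c \<tau> - dual V A b c \<sigma> - 0 \<bullet> (\<tau> - \<sigma>) - ((\<tau> - \<sigma>) \<bullet> (?Q *v (\<tau> - \<sigma>))) / 2 =
      - (1/2) * (?g \<tau> \<bullet> ((?P \<tau> - ?P \<sigma>) *v ?g \<tau>))
      - (?C \<tau> - ?C \<sigma> - qvec A b c x \<bullet> (\<tau> - \<sigma>) - ((\<tau> - \<sigma>) \<bullet> (R *v (\<tau> - \<sigma>))) / 2)"
  proof eventually_elim
    case (elim \<tau>)
    then show ?case
      unfolding form using \<sigma>_dom invertible
      by (simp add: dual matrix_vector_mult_diff_rdistrib inner_diff_right field_simps)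
  qed
  have "((\<lambda>\<tau>. ?P \<tau> - ?P \<sigma>) \<longlongrightarrow> 0) (nhds \<sigma>)"
    using tendsto_matrix_inv[OF tendsto_lincomb invertible] by (simp add: LIM_zero)
  then have "(\<lambda>\<tau>. - (1/2) * (?g \<tau> \<bullet> ((?P \<tau> - ?P \<sigma>) *v ?g \<tau>))) \<in> o[nhds \<sigma>](\<lambda>\<tau>. (norm (\<tau> - \<sigma>))\<^sup>2)"
    by (intro landau_o.small.cmult_in_iff[THEN iffD2] vanishing_matrix_form_smallo) simp_all
  then show ?thesis
    unfolding has_quadratic_expansion_def landau_o.small.in_cong[OF remainder]
    using conj_expansion[unfolded has_quadratic_expansion_def] by (rule sum_in_smallo)
qed

end

section \<open>The extremality test at a critical point\<close>

locale quadratic_critical_point = quadratic_family A b c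
  for A :: "'m::finite option \<Rightarrow> real^'n^'n" and b c +
  fixes V :: "real^'m \<Rightarrow> ereal" and x :: "real^'n" and \<sigma> :: "real^'m"
  assumes Gamma_sc2: "V \<in> Gamma_sc2"
    and x_in_X0: "x \<in> X0 V A b c"
    and critical: "critical_point_Xi V A b c x \<sigma>"
begin

abbreviation V_real :: "real^'m \<Rightarrow> real" where
  "V_real \<equiv> \<lambda>z. real_of_ereal (V z)"

abbreviation primal_real :: "real^'n \<Rightarrow> real" where
  "primal_real \<equiv> \<lambda>y. real_of_ereal (primal V A b c y)"

abbreviation J\<^sub>q :: "real^'n^'m" where
  "J\<^sub>q \<equiv> qvec_jacobian A b x"

abbreviation W :: "real^'m^'m" where
  "W \<equiv> hessian V_real (qvec A b c x)"

lemma qvec_interior: "qvec A b c x \<in> interior (edom V)"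
  using x_in_X0 by (simp add: X0_def)

lemma \<sigma>_interior: "\<sigma> \<in> interior (edom (fenchel_conj V))"
  using critical by (simp add: critical_point_Xi_def)

lemmas proper_V = Gamma_sc2_proper[OF Gamma_sc2]
  and convex_V = Gamma_sc2_econvex[OF Gamma_sc2]
  and GDERIV_V = Gamma_sc2_GDERIV[OF Gamma_sc2]
  and gradient_V_derivative = Gamma_sc2_has_derivative_gradient[OF Gamma_sc2 qvec_interior]
  and hessian_V_pos_definite = Gamma_sc2_pos_definite_hessian[OF Gamma_sc2 qvec_interior]

lemmas stationary = critical_point_Xi_stationary[OF proper_V critical]

lemma gradient_V_eq: "gradient V_real (qvec A b c x) = \<sigma>"
  using proper_V convex_V qvec_interior _ GDERIV_V[OF qvec_interior]
    critical_point_Xi_GDERIV_conj[OF proper_V critical]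
  by (rule gradient_eq_if_gradient_fenchel_conj) (use \<sigma>_interior interior_subset in blast)

lemma has_quadratic_expansion_V: "has_quadratic_expansion V_real (qvec A b c x) \<sigma> ((*v) W)"
proof -
  have "\<forall>\<^sub>F z in nhds (qvec A b c x). z \<in> interior (edom V)"
    using qvec_interior by (intro eventually_nhds_in_open) auto
  then have "\<forall>\<^sub>F z in nhds (qvec A b c x). GDERIV V_real z :> gradient V_real z"
    by eventually_elim (rule GDERIV_V)
  then show ?thesis
    using has_quadratic_expansion_gradient[OF _ gradient_V_derivative] gradient_V_eq by simp
qed

lemma eventually_X0: "\<forall>\<^sub>F y in nhds x. y \<in> X0 V A b c"
  using open_X0 x_in_X0 by (rule eventually_nhds_in_open)

lemma
  shows hessian_primal: "hessian primal_real x = lincomb A \<sigma> + transpose J\<^sub>q ** W ** J\<^sub>q"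
    and has_quadratic_expansion_primal:
      "has_quadratic_expansion primal_real x 0 ((*v) (hessian primal_real x))"
proof -
  let ?g = "\<lambda>y. gradient V_real (qvec A b c y)"
  let ?df = "\<lambda>y. lincomb A (?g y) *v y - lincomb b (?g y)"
  have grad: "\<forall>\<^sub>F y in nhds x. GDERIV primal_real y :> ?df y"
    using eventually_X0
    by eventually_elim (auto intro!: GDERIV_primal proper_V GDERIV_V simp: X0_def)
  have der: "(?df has_derivative (*v) (lincomb A \<sigma> + transpose J\<^sub>q ** W ** J\<^sub>q)) (at x)"
    using has_derivative_gradient_primal[OF gradient_V_derivative] unfolding gradient_V_eq .
  show hess: "hessian primal_real x = lincomb A \<sigma> + transpose J\<^sub>q ** W ** J\<^sub>q"
    using grad der by (rule hessian_eqI)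
  have "?df x = 0"
    by (simp add: gradient_V_eq stationary)
  then show "has_quadratic_expansion primal_real x 0 ((*v) (hessian primal_real x))"
    using has_quadratic_expansion_gradient[OF grad der] by (simp add: hess)
qed

lemma primal_eventually_finite: "\<forall>\<^sub>F y in nhds x. primal V A b c y = ereal (primal_real y)"
  using eventually_X0 by eventually_elim (simp add: primal_eq_on_X0[OF proper_V])

lemma invertible_hessian_V: "invertible W"
  using hessian_V_pos_definite by (intro definite_imp_invertible) (fastforce simp: pos_definite_def)

lemma has_quadratic_expansion_conj:
  "has_quadratic_expansion (\<lambda>\<tau>. real_of_ereal (fenchel_conj V \<tau>)) \<sigma> (qvec A b c x)
     ((*v) (matrix_inv W))"
proof (rule has_quadratic_expansion_fenchel_conj)
  have W: "transpose W = W" "\<And>h. h \<noteq> 0 \<Longrightarrow> h \<bullet> (W *v h) > 0"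
    using hessian_V_pos_definite by (simp_all add: pos_definite_def)
  show "adjoint ((*v) W) = (*v) W"
    using W(1) by (rule adjoint_symmetric_matrix)
  show "h \<bullet> (W *v h) > 0" if "h \<noteq> 0" for h
    using that by (rule W(2))
  show "W *v (matrix_inv W *v h) = h" for h
    by (simp add: matrix_vector_mul_assoc matrix_inv_right invertible_hessian_V)
qed (use proper_V convex_V qvec_interior has_quadratic_expansion_V in simp_all)

end

locale factored_critical_point = quadratic_critical_point A b c V x \<sigma>
  for A :: "'m::finite option \<Rightarrow> real^'n^'n" and b c V x \<sigma> +
  fixes E :: "real^'n^'n" and F :: "real^'m^'m"
  assumes negative: "neg_definite (lincomb A \<sigma>)"
    and nondegenerate: "det (hessian primal_real x) \<noteq> 0"
    and E: "transpose E ** E = - lincomb A \<sigma>"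
    and F: "transpose F ** F = W"
begin

definition H :: "real^'m^'n" where
  "H = transpose (matrix_inv E) ** transpose J\<^sub>q ** transpose F"

lemma invertible_lincomb: "invertible (lincomb A \<sigma>)"
  using negative by (intro definite_imp_invertible) (force simp: neg_definite_def)

lemma lincomb_eq_Gram: "lincomb A \<sigma> = - (transpose E ** E)"
  by (simp add: E)

lemma invertible_E: "invertible E"
proof (rule invertible_Gram_imp_invertible)
  show "invertible (transpose E ** E)"
    unfolding E using negative
    by (intro definite_imp_invertible) (force simp: neg_definite_def minus_matrix_vector_mult)
qed

lemma invertible_F: "invertible F"
  by (rule invertible_Gram_imp_invertible) (simp add: F invertible_hessian_V)

(* The double transpose gives the shape transpose N ** N required by local_maximizer_on_iff_Gram. *)
lemma hessian_primal_factored: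
  "hessian primal_real x = transpose E ** (transpose (transpose H) ** transpose H - mat 1) ** E"
  using Gram_factorization_primal[OF invertible_E invertible_F, of J\<^sub>q]
  by (simp add: hessian_primal lincomb_eq_Gram F H_def)

lemma hessian_dual_factored:
  "- (J\<^sub>q ** matrix_inv (lincomb A \<sigma>) ** transpose J\<^sub>q) - matrix_inv W
     = transpose (transpose (matrix_inv F)) ** (transpose H ** H - mat 1)
         ** transpose (matrix_inv F)"
proof -
  have "matrix_inv (lincomb A \<sigma>) = - matrix_inv (transpose E ** E)"
    unfolding lincomb_eq_Gram using invertible_E
    by (intro matrix_inv_minus invertible_mult transpose_invertible)
  then have "- (J\<^sub>q ** matrix_inv (lincomb A \<sigma>) ** transpose J\<^sub>q)
      = J\<^sub>q ** matrix_inv (transpose E ** E) ** transpose J\<^sub>q"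
    by (simp add: matrix_eq minus_matrix_vector_mult matrix_vector_mult_minus
        flip: matrix_vector_mul_assoc)
  then show ?thesis
    using Gram_factorization_dual[OF invertible_E invertible_F, of J\<^sub>q] by (simp add: F H_def)
qed

lemma invertible_H_Gram: "invertible (transpose H ** H - mat 1)"
proof (rule invertible_mult_minus_id_commute)
  have "det (H ** transpose H - mat 1) \<noteq> 0"
    using nondegenerate by (simp add: hessian_primal_factored det_mul)
  then show "invertible (H ** transpose H - mat 1)"
    by (simp add: invertible_det_nz)
qed

theorem
  shows local_maximizer_primal_iff:
      "local_maximizer_on UNIV (primal V A b c) x \<longleftrightarrow> (\<forall>v. v \<noteq> 0 \<longrightarrow> norm (H *v v) < norm v)"
    and local_minimizer_primal_iff: "CARD('m) = CARD('n) \<Longrightarrow>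
      local_minimizer_on UNIV (primal V A b c) x \<longleftrightarrow> (\<forall>v. v \<noteq> 0 \<longrightarrow> norm (H *v v) > norm v)"
proof -
  have "invertible (transpose (transpose H) ** transpose H - mat 1)"
    using invertible_H_Gram by (simp add: invertible_mult_minus_id_commute)
  note Gram_form = has_quadratic_expansion_primal[unfolded hessian_primal_factored] _
    invertible_E this
  show "local_maximizer_on UNIV (primal V A b c) x \<longleftrightarrow> (\<forall>v. v \<noteq> 0 \<longrightarrow> norm (H *v v) < norm v)"
    using local_maximizer_on_iff_Gram[OF Gram_form]
    by (simp add: local_maximizer_on_ereal_iff[OF _ primal_eventually_finite]
        norm_transpose_less_iff)
  show "local_minimizer_on UNIV (primal V A b c) x \<longleftrightarrow> (\<forall>v. v \<noteq> 0 \<longrightarrow> norm (H *v v) > norm v)"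
    if "CARD('m) = CARD('n)"
    using local_minimizer_on_iff_Gram[OF Gram_form]
    by (simp add: local_minimizer_on_ereal_iff[OF _ primal_eventually_finite]
        norm_transpose_greater_iff[OF that])
qed

theorem
  shows local_maximizer_dual_iff:
      "local_maximizer_on (S_col V A b) (dual V A b c) \<sigma> \<longleftrightarrow> (\<forall>v. v \<noteq> 0 \<longrightarrow> norm (H *v v) < norm v)"
    and local_minimizer_dual_iff:
      "local_minimizer_on (S_col V A b) (dual V A b c) \<sigma> \<longleftrightarrow> (\<forall>v. v \<noteq> 0 \<longrightarrow> norm (H *v v) > norm v)"
proof -
  have "invertible (matrix_inv F)"
    using invertible_F matrix_inv_left matrix_inv_right unfolding invertible_def by blast
  note Gram_form = has_quadratic_expansion_dual[OF proper_V \<sigma>_interior invertible_lincomb stationary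
      has_quadratic_expansion_conj, unfolded hessian_dual_factored]
    mem_interior_S_col[OF \<sigma>_interior invertible_lincomb]
    transpose_invertible[OF this] invertible_H_Gram
  show "local_maximizer_on (S_col V A b) (dual V A b c) \<sigma> \<longleftrightarrow> (\<forall>v. v \<noteq> 0 \<longrightarrow> norm (H *v v) < norm v)"
    by (rule local_maximizer_on_iff_Gram[OF Gram_form])
  show "local_minimizer_on (S_col V A b) (dual V A b c) \<sigma> \<longleftrightarrow> (\<forall>v. v \<noteq> 0 \<longrightarrow> norm (H *v v) > norm v)"
    by (rule local_minimizer_on_iff_Gram[OF Gram_form])
qed

end

theorem corollary10:
  fixes V :: "real^'m \<Rightarrow> ereal"
    and A :: "'m option \<Rightarrow> real^'n^'n"
    and b :: "'m option \<Rightarrow> real^'n"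
    and c :: "'m option \<Rightarrow> real"
    and x :: "real^'n" and \<sigma> :: "real^'m"
    and E :: "real^'n^'n" and F :: "real^'m^'m"
    and d :: "'m \<Rightarrow> real^'n"
    and J H :: "real^'m \<Rightarrow> real^'n"
  assumes "V \<in> Gamma_sc2"
    and "\<And>k. transpose (A k) = A k"
    and "x \<in> X0 V A b c" and "\<sigma> \<in> S_neg V A"
    and "critical_point_Xi V A b c x \<sigma>"
    and "det (hessian (\<lambda>y. real_of_ereal (primal V A b c y)) x) \<noteq> 0"
    and "transpose E ** E = - lincomb A \<sigma>"
    and "transpose F ** F = hessian (\<lambda>y. real_of_ereal (V y)) (qvec A b c x)"
    and "\<And>i. d i = transpose (matrix_inv E) *v (A (Some i) *v x - b (Some i))"
    and "\<And>v. J v = (\<Sum>i\<in>UNIV. (v $ i) *\<^sub>R d i)"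
    and "H = J \<circ> (*v) (transpose F)"
  shows "((local_maximizer_on UNIV (primal V A b c) x \<longleftrightarrow> (\<forall>v\<in>sphere 0 1. norm (H v) < 1)) \<and>
          ((\<forall>v\<in>sphere 0 1. norm (H v) < 1) \<longleftrightarrow> local_maximizer_on (S_col V A b) (dual V A b c) \<sigma>)) \<and>
         (CARD('m) = CARD('n) \<longrightarrow>
          (local_minimizer_on UNIV (primal V A b c) x \<longleftrightarrow> (\<forall>v\<in>sphere 0 1. norm (H v) > 1)) \<and>
          ((\<forall>v\<in>sphere 0 1. norm (H v) > 1) \<longleftrightarrow> local_minimizer_on (S_col V A b) (dual V A b c) \<sigma>))"
proof -
  interpret crit: factored_critical_point A b c V x \<sigma> E F
    using assms(1-8) by unfold_locales (simp_all add: S_neg_def)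
  have "J v = transpose (matrix_inv E) *v (transpose (qvec_jacobian A b x) *v v)" for v
    by (simp add: assms(9,10) transpose_qvec_jacobian_mult linear_sum[OF matrix_vector_mul_linear]
        matrix_vector_mult_scaleR)
  then have H: "H = (*v) crit.H"
    by (simp add: fun_eq_iff assms(11) crit.H_def flip: matrix_vector_mul_assoc)
  have less: "(\<forall>v\<in>sphere 0 1. norm (H v) < 1) \<longleftrightarrow> (\<forall>v. v \<noteq> 0 \<longrightarrow> norm (crit.H *v v) < norm v)"
    unfolding H linear_norm_sphere_iff[OF matrix_vector_mul_linear, where P = "\<lambda>r. r < 1"]
    by (simp add: divide_less_eq)
  have greater: "(\<forall>v\<in>sphere 0 1. norm (H v) > 1) \<longleftrightarrow> (\<forall>v. v \<noteq> 0 \<longrightarrow> norm (crit.H *v v) > norm v)"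
    unfolding H linear_norm_sphere_iff[OF matrix_vector_mul_linear, where P = "\<lambda>r. 1 < r"]
    by (simp add: less_divide_eq)
  show ?thesis
    unfolding less greater crit.local_maximizer_primal_iff
      crit.local_maximizer_dual_iff crit.local_minimizer_dual_iff
    using crit.local_minimizer_primal_iff by blast
qed

end
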